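(* Let $f\colon\mathbb{S}^1\to\mathbb{S}^1$ be a $C^2$ endomorphism of the circle with finitely many turning points. Suppose that $f$ is transitive and satisfies the $\alpha$-Hölder shadowing property with $\alpha>\frac12$. Then $f$ is topologically conjugate to a linear expanding endomorphism of the circle.
   Context: $\mathbb{S}^1=\mathbb{R}/\mathbb{Z}$ with its usual distance $d$. An endomorphism of the circle is a (not necessarily invertible) map $\mathbb{S}^1\to\mathbb{S}^1$ of the stated smoothness. A point $c$ is a turning point of $f$ if $f'(c)=0$ and $c$ is a local minimum or a local maximum of $f$ (in local coordinates, i.e. of a lift of $f$ to $\mathbb{R}$). $f$ is transitive if it has a dense forward orbit. For $\epsilon>0$, an $\epsilon$-pseudo-orbit of $f$ is a sequence $\{x_n\}_{n\ge 0}$ with $d(f(x_n),x_{n+1})<\epsilon$ for all $n\geq 0$; it is $\eta$-shadowed by the orbit of $x$ if $d(f^n(x),x_n)<\eta$ for all $n\ge 0$. For $\alpha\le 1$, $f$ has the $\alpha$-Hölder shadowing property if there exists $C>0$ such that for every $\epsilon>0$, any $\epsilon$-pseudo-orbit is $C\epsilon^\alpha$-shadowed by an orbit of $f$. A linear expanding endomorphism is a map $E_k\colon x\mapsto kx \pmod 1$ with $k\in\mathbb{Z}$, $|k|\ge 2$. *)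

theory Defs
  imports "HOL-Analysis.Analysis"
begin

quotient_type circle = real / "\<lambda>x y :: real. x - y \<in> \<int>"
  morphisms rep_circle proj_circle
proof (rule equivpI)
  show "reflp (\<lambda>x y :: real. x - y \<in> \<int>)"
    by (simp add: reflp_def)
  show "symp (\<lambda>x y :: real. x - y \<in> \<int>)"
    by (auto intro!: sympI dest: Ints_minus)
  show "transp (\<lambda>x y :: real. x - y \<in> \<int>)"
  proof (rule transpI)
    fix x y z :: real
    assume "x - y \<in> \<int>" "y - z \<in> \<int>"
    then have "(x - y) + (y - z) \<in> \<int>"
      by (rule Ints_add)
    then show "x - z \<in> \<int>"
      by simp
  qed
qed

lemma round_diff_le: "\<bar>x - of_int (round x)\<bar> \<le> \<bar>x - of_int n\<bar>" for x :: real
  using round_diff_minimal[of x n] by (simp add: abs_minus_commute)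

instantiation circle :: metric_space
begin

text \<open>The quotient distance: \<open>d(x, y)\<close> is the distance from \<open>x - y\<close> to the nearest integer.\<close>

lift_definition dist_circle :: "circle \<Rightarrow> circle \<Rightarrow> real"
  is "\<lambda>x y. \<bar>(x - y) - of_int (round (x - y))\<bar>"
proof -
  fix x x' y y' :: real
  assume "x - x' \<in> \<int>" "y - y' \<in> \<int>"
  then obtain m n where "x - x' = of_int m" "y - y' = of_int n"
    by (auto elim!: Ints_cases)
  then have eq: "x - y = x' - y' + of_int (m - n)"
    by simp
  show "\<bar>(x - y) - of_int (round (x - y))\<bar> = \<bar>(x' - y') - of_int (round (x' - y'))\<bar>"
  proof (rule antisym)
    show "\<bar>(x - y) - of_int (round (x - y))\<bar> \<le> \<bar>(x' - y') - of_int (round (x' - y'))\<bar>"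
      using round_diff_le[of "x - y" "round (x' - y') + (m - n)"] eq
      by (smt (verit) of_int_add)
    show "\<bar>(x' - y') - of_int (round (x' - y'))\<bar> \<le> \<bar>(x - y) - of_int (round (x - y))\<bar>"
      using round_diff_le[of "x' - y'" "round (x - y) - (m - n)"] eq
      by (smt (verit) of_int_diff)
  qed
qed

definition uniformity_circle :: "(circle \<times> circle) filter"
  where "uniformity_circle = (INF e\<in>{0<..}. principal {(x, y). dist x y < e})"

definition open_circle :: "circle set \<Rightarrow> bool"
  where "open_circle U \<longleftrightarrow> (\<forall>x\<in>U. \<forall>\<^sub>F (x', y) in uniformity. x' = x \<longrightarrow> y \<in> U)"

instance
proof
  fix x y z :: circle
  show "dist x y = 0 \<longleftrightarrow> x = y"
  proof transfer
    fix x y :: real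
    have "x - y \<in> \<int>" if "x - y = of_int (round (x - y))"
      by (subst that) (rule Ints_of_int)
    moreover have "of_int (round (x - y)) = x - y" if "x - y \<in> \<int>"
      using that by (auto elim!: Ints_cases)
    ultimately show "\<bar>(x - y) - of_int (round (x - y))\<bar> = 0 \<longleftrightarrow> x - y \<in> \<int>"
      by auto
  qed
  show "dist x y \<le> dist x z + dist y z"
  proof transfer
    fix x y z :: real
    show "\<bar>(x - y) - of_int (round (x - y))\<bar>
        \<le> \<bar>(x - z) - of_int (round (x - z))\<bar> + \<bar>(y - z) - of_int (round (y - z))\<bar>"
      using round_diff_le[of "x - y" "round (x - z) - round (y - z)"] by simp
  qed
qed (simp_all only: uniformity_circle_def open_circle_def)

end

definition is_lift :: "(circle \<Rightarrow> circle) \<Rightarrow> (real \<Rightarrow> real) \<Rightarrow> bool"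
  where "is_lift f F \<longleftrightarrow>
    continuous_on UNIV F \<and> (\<forall>x. proj_circle (F x) = f (proj_circle x))"

definition C2_real :: "(real \<Rightarrow> real) \<Rightarrow> bool"
  where "C2_real F \<longleftrightarrow> (\<exists>F' F''.
    (\<forall>x. (F has_real_derivative F' x) (at x)) \<and>
    (\<forall>x. (F' has_real_derivative F'' x) (at x)) \<and>
    continuous_on UNIV F'')"

text \<open>Continuous lifts of the same map differ by an integer constant, so the choice of the lift
  is immaterial in the next two definitions.\<close>

definition C2_endomorphism :: "(circle \<Rightarrow> circle) \<Rightarrow> bool"
  where "C2_endomorphism f \<longleftrightarrow> (\<exists>F. is_lift f F \<and> C2_real F)"

definition turning_point :: "(circle \<Rightarrow> circle) \<Rightarrow> circle \<Rightarrow> bool"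
  where "turning_point f c \<longleftrightarrow> (\<exists>F x.
    is_lift f F \<and> proj_circle x = c \<and> (F has_real_derivative 0) (at x) \<and>
    ((\<forall>\<^sub>F y in nhds x. F x \<le> F y) \<or> (\<forall>\<^sub>F y in nhds x. F y \<le> F x)))"

definition transitive_map :: "('a::topological_space \<Rightarrow> 'a) \<Rightarrow> bool"
  where "transitive_map f \<longleftrightarrow> (\<exists>x. closure (range (\<lambda>n. (f ^^ n) x)) = UNIV)"

definition pseudo_orbit :: "('a::metric_space \<Rightarrow> 'a) \<Rightarrow> real \<Rightarrow> (nat \<Rightarrow> 'a) \<Rightarrow> bool"
  where "pseudo_orbit f \<epsilon> xs \<longleftrightarrow> (\<forall>n. dist (f (xs n)) (xs (Suc n)) < \<epsilon>)"

definition shadowed_by :: "('a::metric_space \<Rightarrow> 'a) \<Rightarrow> real \<Rightarrow> (nat \<Rightarrow> 'a) \<Rightarrow> 'a \<Rightarrow> bool"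
  where "shadowed_by f \<eta> xs x \<longleftrightarrow> (\<forall>n. dist ((f ^^ n) x) (xs n) < \<eta>)"

definition holder_shadowing :: "real \<Rightarrow> ('a::metric_space \<Rightarrow> 'a) \<Rightarrow> bool"
  where "holder_shadowing \<alpha> f \<longleftrightarrow> (\<exists>C>0. \<forall>\<epsilon>>0. \<forall>xs.
    pseudo_orbit f \<epsilon> xs \<longrightarrow> (\<exists>x. shadowed_by f (C * \<epsilon> powr \<alpha>) xs x))"

lift_definition linear_endomorphism :: "int \<Rightarrow> circle \<Rightarrow> circle"
  is "\<lambda>k x. of_int k * x"
  using Ints_mult[OF Ints_of_int] by (fastforce simp flip: right_diff_distrib)

definition topologically_conjugate ::
    "('a::topological_space \<Rightarrow> 'a) \<Rightarrow> ('b::topological_space \<Rightarrow> 'b) \<Rightarrow> bool"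
  where "topologically_conjugate f g \<longleftrightarrow>
    (\<exists>h h'. homeomorphism UNIV UNIV h h' \<and> h \<circ> f = g \<circ> h)"

end

theory Submission
  imports Defs
begin

text \<open>
  Suppose first that there are turning points. A pseudo-orbit may start close to a turning point
  \<open>c\<close> and jump by less than \<open>\<epsilon>\<close> across the extremal value \<open>f(c)\<close>, whereas orbits passing within
  \<open>\<eta> = C\<epsilon>\<^sup>\<alpha>\<close> cannot cross it, because \<open>\<eta>\<^sup>2 = o(\<epsilon>)\<close>. So the arc between the pseudo-orbit and the
  orbit shadowing it contains an arc around \<open>f(c)\<close> of radius \<open>\<epsilon>/8\<close>. Its images have length less
  than \<open>\<eta>\<close> until one of them meets a turning point \<open>c'\<close>; the next image then has length
  \<open>O(\<eta>\<^sup>2)\<close> and lies in the corresponding arc around \<open>f(c')\<close>, and the argument repeats. Hence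
  \<open>f\<close> is not sensitive to initial conditions. A transitive map without sensitivity has iterates
  arbitrarily close to the identity, so it is injective, which is absurd at a turning point.

  Without turning points the lift \<open>F\<close> is strictly monotone, so its degree \<open>d\<close> is not \<open>0\<close>.
  Degree \<open>-1\<close> contradicts transitivity since \<open>F\<close> has a fixed point, and degree \<open>1\<close> contradicts
  shadowing, since pseudo-orbits can move more slowly than all orbits. If \<open>|d| \<ge> 2\<close>, the
  semiconjugacy \<open>lim F\<^sup>n / d\<^sup>n\<close> to the linear map is injective by transitivity.
\<close>

section \<open>The circle and dense orbits\<close>

lemma proj_circle_eq_iff: "proj_circle x = proj_circle y \<longleftrightarrow> x - y \<in> \<int>"
  by (fact circle.abs_eq_iff)

lemma proj_circle_add_of_int [simp]: "proj_circle (x + of_int m) = proj_circle x"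
  by (simp add: proj_circle_eq_iff)

lemma proj_circle_diff_of_int [simp]: "proj_circle (x - of_int m) = proj_circle x"
  by (simp add: proj_circle_eq_iff)

lemma proj_circle_eqE:
  assumes "proj_circle x = proj_circle y"
  obtains m :: int where "x = y + of_int m"
proof -
  obtain m :: int where "x - y = of_int m"
    using assms by (auto simp: proj_circle_eq_iff elim: Ints_cases)
  then show ?thesis
    using that[of m] by (simp add: algebra_simps)
qed

lemma proj_rep_circle [simp]: "proj_circle (rep_circle c) = c"
  using Quotient3_abs_rep[OF Quotient3_circle] by blast

lemma dist_proj_circle:
  "dist (proj_circle x) (proj_circle y) = \<bar>(x - y) - of_int (round (x - y))\<bar>"
  by (fact dist_circle.abs_eq)

lemma dist_proj_circle_le: "dist (proj_circle x) (proj_circle y) \<le> \<bar>x - y\<bar>"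
  using round_diff_le[of "x - y" 0] by (simp add: dist_proj_circle)

text \<open>Every nonzero integer is at distance at least \<open>1 / 2\<close> from
  \<open>x - y\<close>, so \<open>0\<close> is a nearest one. This turns closeness on the circle
  back into closeness of lifts.\<close>

lemma dist_proj_circle_eq:
  assumes "\<bar>x - y\<bar> \<le> 1 / 2"
  shows "dist (proj_circle x) (proj_circle y) = \<bar>x - y\<bar>"
proof (rule antisym[OF dist_proj_circle_le])
  define n where "n = round (x - y)"
  show "\<bar>x - y\<bar> \<le> dist (proj_circle x) (proj_circle y)"
  proof (cases "n = 0")
    case False
    then have "1 \<le> \<bar>real_of_int n\<bar>"
      by (metis of_int_1_le_iff of_int_abs zero_less_abs_iff zless_imp_add1_zle add_0)
    then show ?thesis
      using assms unfolding dist_proj_circle n_def[symmetric] by linarith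
  qed (simp add: dist_proj_circle flip: n_def)
qed

lemma inj_on_proj_circle: "inj_on proj_circle {a..<a + 1}"
proof (rule inj_onI)
  fix x y assume xy: "x \<in> {a..<a + 1}" "y \<in> {a..<a + 1}" "proj_circle x = proj_circle y"
  obtain m :: int where m: "x = y + of_int m"
    using xy(3) by (rule proj_circle_eqE)
  then have "\<bar>real_of_int m\<bar> < 1"
    using xy(1,2) by auto
  then show "x = y"
    using m by (simp flip: of_int_abs)
qed

text \<open>Rounding selects the representative on the sheet nearest to \<open>x\<close>, where the
  circle distance is attained on the line.\<close>

lemma obtain_near_lift:
  obtains x' where "proj_circle x' = c" "\<bar>x' - x\<bar> = dist c (proj_circle x)"
proof
  define y where "y = rep_circle c"
  show "proj_circle (y - of_int (round (y - x))) = c"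
    by (simp add: y_def)
  have "dist c (proj_circle x) = dist (proj_circle y) (proj_circle x)"
    by (simp add: y_def)
  then show "\<bar>y - of_int (round (y - x)) - x\<bar> = dist c (proj_circle x)"
    by (simp add: dist_proj_circle algebra_simps)
qed

lemma continuous_on_proj_circle: "continuous_on S proj_circle"
  unfolding continuous_on_iff dist_real_def
  using dist_proj_circle_le le_less_trans by blast

lemma open_proj_circle_image:
  assumes "open V"
  shows "open (proj_circle ` V)"
  unfolding open_dist
proof
  fix c assume "c \<in> proj_circle ` V"
  then obtain x where x: "x \<in> V" "c = proj_circle x"
    by blast
  then obtain e where e: "e > 0" "\<And>y. dist y x < e \<Longrightarrow> y \<in> V"
    using assms open_dist by blast
  have "c' \<in> proj_circle ` V" if "dist c' c < e" for c'
    using obtain_near_lift[of c' x] e(2) that x(2) by (metis dist_real_def imageI)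
  with e(1) show "\<exists>e>0. \<forall>y. dist y c < e \<longrightarrow> y \<in> proj_circle ` V"
    by blast
qed

text \<open>Without isolated points, a dense orbit returns to every nonempty open set at arbitrarily
  late times.\<close>

instance circle :: perfect_space
proof
  fix c :: circle
  show "\<not> open {c}"
  proof
    assume "open {c}"
    then obtain e where e: "e > 0" "\<And>y. dist y c < e \<Longrightarrow> y = c"
      unfolding open_dist by blast
    define x d where "x = rep_circle c" and "d = min (e / 2) (1 / 2)"
    have "dist (proj_circle (x + d)) (proj_circle x) = d"
      using e(1) by (subst dist_proj_circle_eq) (auto simp: d_def)
    then have "0 < dist (proj_circle (x + d)) c" "dist (proj_circle (x + d)) c < e"
      using e(1) by (auto simp: d_def x_def)
    then show False
      using e(2) by fastforce
  qed
qed

section \<open>Dense orbits in spaces without isolated points\<close>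

definition dense_orbit :: "('a::topological_space \<Rightarrow> 'a) \<Rightarrow> 'a \<Rightarrow> bool"
  where "dense_orbit f x \<longleftrightarrow> closure (range (\<lambda>n. (f ^^ n) x)) = UNIV"

lemma open_minus_finite_nonempty:
  fixes U :: "'a::{perfect_space, t1_space} set"
  assumes "finite A" "open U" "U \<noteq> {}"
  shows "U - A \<noteq> {}"
proof -
  obtain x where x: "x \<in> U"
    using assms(3) by blast
  have "x islimpt UNIV"
    using not_open_singleton by (simp add: islimpt_UNIV_iff)
  then have "infinite U"
    using x assms(2) islimpt_eq_acc_point by force
  then show ?thesis
    using finite_subset[OF _ assms(1), of U] by auto
qed

text \<open>Removing the first \<open>N\<close> orbit points from \<open>U\<close> leaves a nonempty
  open set, which the orbit must still meet.\<close>

lemma dense_orbit_visits: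
  fixes f :: "'a::{perfect_space, t1_space} \<Rightarrow> 'a"
  assumes "dense_orbit f x" "open U" "U \<noteq> {}"
  shows "\<exists>n\<ge>N. (f ^^ n) x \<in> U"
proof -
  define A where "A = (\<lambda>n. (f ^^ n) x) ` {..<N}"
  have A: "finite A"
    by (simp add: A_def)
  have "open (U - A)"
    by (rule open_Diff[OF assms(2) finite_imp_closed[OF A]])
  moreover have "U - A \<noteq> {}"
    by (rule open_minus_finite_nonempty[OF A assms(2,3)])
  ultimately have "(U - A) \<inter> range (\<lambda>n. (f ^^ n) x) \<noteq> {}"
    using assms(1) open_Int_closure_eq_empty[of "U - A" "range (\<lambda>n. (f ^^ n) x)"]
    unfolding dense_orbit_def by simp
  then obtain n where "(f ^^ n) x \<in> U" "(f ^^ n) x \<notin> A"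
    by blast
  then have "n \<ge> N"
    by (auto simp: A_def)
  with \<open>(f ^^ n) x \<in> U\<close> show ?thesis
    by blast
qed

lemma dense_orbit_tail:
  fixes f :: "'a::{perfect_space, t1_space} \<Rightarrow> 'a"
  assumes "dense_orbit f x"
  shows "dense_orbit f ((f ^^ m) x)"
  unfolding dense_orbit_def
proof (rule ccontr)
  assume "closure (range (\<lambda>n. (f ^^ n) ((f ^^ m) x))) \<noteq> UNIV" (is "closure ?R \<noteq> _")
  then obtain n where n: "n \<ge> m" "(f ^^ n) x \<in> - closure ?R"
    using dense_orbit_visits[OF assms, of "- closure ?R" m] by auto
  have "(f ^^ n) x = (f ^^ (n - m)) ((f ^^ m) x)"
    using n(1) by (simp flip: funpow_add comp_apply[of "f ^^ (n - m)"])
  then have "(f ^^ n) x \<in> ?R"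
    by (rule range_eqI)
  then show False
    using n(2) closure_subset[of ?R] by auto
qed

lemma continuous_on_funpow:
  fixes f :: "'a::topological_space \<Rightarrow> 'a"
  assumes "continuous_on UNIV f"
  shows "continuous_on UNIV (f ^^ n)"
proof (induction n)
  case (Suc n)
  then show ?case
    using continuous_on_compose[OF Suc, of f] continuous_on_subset[OF assms] by simp
qed (simp add: id_def continuous_on_id)

text \<open>The orbit would have only the \<open>n\<close> limit points \<open>f\<^sup>i(q)\<close>, \<open>i < n\<close>.\<close>

lemma not_dense_orbit_if_convergent:
  fixes f :: "'a::{perfect_space, t2_space} \<Rightarrow> 'a"
  assumes cont: "continuous_on UNIV f" and n: "n > 0"
    and lim: "(\<lambda>k. (f ^^ (n * k)) z) \<longlonglongrightarrow> q"
  shows "\<not> dense_orbit f z"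
proof
  assume dense: "dense_orbit f z"
  define Q where "Q = (\<lambda>i. (f ^^ i) q) ` {..<n}"
  have "UNIV - Q \<noteq> {}"
    by (rule open_minus_finite_nonempty) (auto simp: Q_def)
  then obtain p where p: "p \<notin> Q"
    by blast
  have "\<exists>U V. open U \<and> open V \<and> (f ^^ i) q \<in> U \<and> p \<in> V \<and> U \<inter> V = {}" if "i < n" for i
    using p that by (intro hausdorff) (auto simp: Q_def)
  then obtain U V where UV: "\<And>i. i < n \<Longrightarrow> open (U i) \<and> open (V i) \<and>
      (f ^^ i) q \<in> U i \<and> p \<in> V i \<and> U i \<inter> V i = {}"
    by metis
  have "\<forall>\<^sub>F k in sequentially. (f ^^ i) ((f ^^ (n * k)) z) \<in> U i" if "i < n" for i
  proof -
    have "(\<lambda>k. (f ^^ i) ((f ^^ (n * k)) z)) \<longlonglongrightarrow> (f ^^ i) q"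
      using continuous_on_tendsto_compose[OF continuous_on_funpow[OF cont] lim] by simp
    then show ?thesis
      using UV that topological_tendstoD by blast
  qed
  then have "\<forall>\<^sub>F k in sequentially. \<forall>i\<in>{..<n}. (f ^^ i) ((f ^^ (n * k)) z) \<in> U i"
    by (intro eventually_ball_finite) auto
  then obtain K where K: "\<And>k i. k \<ge> K \<Longrightarrow> i < n \<Longrightarrow> (f ^^ i) ((f ^^ (n * k)) z) \<in> U i"
    unfolding eventually_sequentially by blast
  have "open (\<Inter>i<n. V i)" "p \<in> (\<Inter>i<n. V i)"
    using UV by auto
  then obtain m where m: "m \<ge> n * K" "(f ^^ m) z \<in> (\<Inter>i<n. V i)"
    using dense_orbit_visits[OF dense] by blast
  \<comment> \<open>Division of the late time \<open>m\<close> by \<open>n\<close> puts the orbit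
    point into one of the \<open>U i\<close>, although it was chosen in all the
    \<open>V i\<close>.\<close>
  have "m div n \<ge> K" "m mod n < n"
    using m(1) n by (simp_all add: less_eq_div_iff_mult_less_eq mult.commute)
  moreover have "(f ^^ (m mod n)) ((f ^^ (n * (m div n))) z) = (f ^^ m) z"
    by (simp flip: funpow_add comp_apply[of "f ^^ (m mod n)"])
  ultimately have "(f ^^ m) z \<in> U (m mod n)"
    using K by metis
  then show False
    using m(2) UV[OF \<open>m mod n < n\<close>] \<open>m mod n < n\<close> by blast
qed

text \<open>If the orbit of \<open>z\<close> enters \<open>U\<close> at times \<open>m\<close> and \<open>m + k\<close>, then \<open>f\<^sup>k\<close> moves no point
  of the dense orbit of \<open>f\<^sup>m(z)\<close> by more than \<open>\<eta>\<close>. So some positive iterates of \<open>f\<close> are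
  arbitrarily close to the identity.\<close>

lemma inj_if_transitive_not_sensitive:
  fixes f :: "'a::{metric_space, perfect_space} \<Rightarrow> 'a"
  assumes cont: "continuous_on UNIV f" and dense: "dense_orbit f z"
    and stable: "\<And>\<eta>. \<eta> > 0 \<Longrightarrow> \<exists>U. open U \<and> U \<noteq> {} \<and>
      (\<forall>i. \<forall>u\<in>U. \<forall>v\<in>U. dist ((f ^^ i) u) ((f ^^ i) v) \<le> \<eta>)"
  shows "inj f"
proof (rule injI, rule ccontr)
  fix a b assume ab: "f a = f b" "a \<noteq> b"
  define \<eta> where "\<eta> = dist a b / 3"
  have "\<eta> > 0"
    using ab by (simp add: \<eta>_def)
  then obtain U where U: "open U" "U \<noteq> {}"
    "\<And>i u v. u \<in> U \<Longrightarrow> v \<in> U \<Longrightarrow> dist ((f ^^ i) u) ((f ^^ i) v) \<le> \<eta>"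
    using stable[of \<eta>] by auto
  obtain m where m: "(f ^^ m) z \<in> U"
    using dense_orbit_visits[OF dense U(1,2)] by blast
  obtain l where l: "l \<ge> Suc m" "(f ^^ l) z \<in> U"
    using dense_orbit_visits[OF dense U(1,2)] by blast
  define k where "k = l - m"
  have k: "k > 0" "l = k + m"
    using l(1) by (auto simp: k_def)
  have "range (\<lambda>i. (f ^^ i) ((f ^^ m) z)) \<subseteq> {w. dist ((f ^^ k) w) w \<le> \<eta>}"
  proof clarify
    fix i
    have "(f ^^ k) ((f ^^ i) ((f ^^ m) z)) = (f ^^ i) ((f ^^ l) z)"
      by (simp add: k(2) add_ac flip: funpow_add comp_apply[of "f ^^ k"] comp_apply[of "f ^^ i"] comp_apply[of "f ^^ (k + i)"])
    then show "dist ((f ^^ k) ((f ^^ i) ((f ^^ m) z))) ((f ^^ i) ((f ^^ m) z)) \<le> \<eta>"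
      using U(3)[OF l(2) m, of i] by simp
  qed
  then have "closure (range (\<lambda>i. (f ^^ i) ((f ^^ m) z))) \<subseteq> {w. dist ((f ^^ k) w) w \<le> \<eta>}"
    by (rule closure_minimal)
      (intro closed_Collect_le continuous_on_dist continuous_on_const continuous_on_id
        continuous_on_funpow cont)
  then have near: "dist ((f ^^ k) w) w \<le> \<eta>" for w
    using dense_orbit_tail[OF dense, of m] unfolding dense_orbit_def by auto
  \<comment> \<open>As \<open>k\<close> is positive, \<open>f a = f b\<close> forces equal images
    under \<open>f ^^ k\<close>. This common point is within \<open>\<eta>\<close> of both
    \<open>a\<close> and \<open>b\<close>, too close for a third of their distance.\<close>
  obtain j where "k = Suc j"
    using k(1) gr0_implies_Suc by blast
  then have "(f ^^ k) a = (f ^^ k) b"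
    using ab(1) by (simp add: funpow_Suc_right del: funpow.simps)
  then have "dist a b \<le> 2 * \<eta>"
    using near[of a] near[of b] dist_triangle3[of a b "(f ^^ k) a"] by simp
  then show False
    using \<open>\<eta> > 0\<close> by (simp add: \<eta>_def)
qed

section \<open>Lifts\<close>

lemma continuous_int_valued_const:
  fixes g :: "real \<Rightarrow> real"
  assumes cont: "continuous_on UNIV g" and int: "\<And>x. g x \<in> \<int>"
  shows "\<exists>m::int. \<forall>x. g x = of_int m"
proof -
  obtain m where m: "g 0 = of_int m"
    using int[of 0] by (auto elim: Ints_cases)
  have "g constant_on UNIV"
  proof (rule continuous_discrete_range_constant[OF connected_UNIV cont])
    fix x :: real
    have "1 \<le> norm (g y - g x)" if "g y \<noteq> g x" for y
      using int[of x] int[of y] that by (auto elim!: Ints_cases simp flip: of_int_diff)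
    then show "\<exists>e>0. \<forall>y. y \<in> UNIV \<and> g y \<noteq> g x \<longrightarrow> e \<le> norm (g y - g x)"
      using zero_less_one by blast
  qed
  then have "\<forall>x. g x = of_int m"
    unfolding constant_on_def using m by (metis UNIV_I)
  then show ?thesis ..
qed

lemma is_lift_continuous:
  assumes "is_lift f F"
  shows "continuous_on UNIV f"
  unfolding continuous_on_iff
proof (intro ballI allI impI)
  fix c :: circle and e :: real
  assume e: "e > 0"
  define x where "x = rep_circle c"
  obtain \<delta> where \<delta>: "\<delta> > 0" "\<And>y. dist y x < \<delta> \<Longrightarrow> dist (F y) (F x) < e"
    using assms e unfolding is_lift_def continuous_on_iff by blast
  have "dist (f c') (f c) < e" if "dist c' c < \<delta>" for c'
  proof -
    obtain y where y: "proj_circle y = c'" "\<bar>y - x\<bar> = dist c' c"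
      using obtain_near_lift[of c' x] unfolding x_def by auto
    have "f c' = proj_circle (F y)" "f c = proj_circle (F x)"
      using assms y(1) by (auto simp: is_lift_def x_def)
    then have "dist (f c') (f c) \<le> \<bar>F y - F x\<bar>"
      using dist_proj_circle_le by simp
    also have "\<dots> < e"
      using \<delta>(2)[of y] y(2) that by (simp add: dist_real_def)
    finally show ?thesis .
  qed
  with \<delta>(1) show "\<exists>\<delta>>0. \<forall>c'\<in>UNIV. dist c' c < \<delta> \<longrightarrow> dist (f c') (f c) < e"
    by blast
qed

lemma is_lift_diff:
  assumes "is_lift f F" "is_lift f G"
  shows "\<exists>m::int. \<forall>x. G x = F x + of_int m"
proof -
  have cont: "continuous_on UNIV (\<lambda>x. G x - F x)"
    using assms unfolding is_lift_def by (auto intro: continuous_on_diff)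
  have "G x - F x \<in> \<int>" for x
    using assms by (simp add: is_lift_def flip: proj_circle_eq_iff)
  from continuous_int_valued_const[OF cont this] show ?thesis
    by (simp add: diff_eq_eq add.commute)
qed

lemma is_lift_degree:
  assumes "is_lift f F"
  shows "\<exists>d::int. \<forall>x. F (x + 1) = F x + of_int d"
proof -
  have "continuous_on UNIV F"
    using assms by (simp add: is_lift_def)
  then have "continuous_on UNIV (\<lambda>x. F (x + 1))"
    by (rule continuous_on_compose2) (auto intro!: continuous_on_add)
  moreover have "proj_circle (x + 1) = proj_circle x" for x
    using proj_circle_add_of_int[of x 1] by simp
  ultimately have "is_lift f (\<lambda>x. F (x + 1))"
    using assms by (simp add: is_lift_def)
  from is_lift_diff[OF assms this] show ?thesis .
qed

text \<open>Stated for an arbitrary function, because it also serves periodic functions (degree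
  \<open>0\<close>) and conjugacies (degree \<open>1\<close>).\<close>

lemma degree_add_of_int:
  fixes F :: "real \<Rightarrow> real" and d m :: int
  assumes degree: "\<And>x. F (x + 1) = F x + of_int d"
  shows "F (x + of_int m) = F x + of_int (d * m)"
proof -
  have nat: "F (x + of_nat n) = F x + of_int (d * int n)" for x n
  proof (induction n)
    case (Suc n)
    have "F (x + of_nat (Suc n)) = F ((x + of_nat n) + 1)"
      by (simp add: add_ac)
    then show ?case
      unfolding degree Suc by (simp add: algebra_simps)
  qed simp
  show ?thesis
  proof (cases m)
    case (nonneg n)
    then show ?thesis using nat by simp
  next
    case (neg n)
    then have "F x = F (x + of_int m) + of_int (d * int (Suc n))"
      using nat[of "x + of_int m" "Suc n"] by simp
    then show ?thesis
      unfolding neg by (simp add: algebra_simps)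
  qed
qed

text \<open>Integer translations change \<open>F\<close> by integers, so the choice made by
  \<open>rep_circle\<close> does not matter. This yields circle maps from functions constructed on
  the line.\<close>

lemma is_lift_descend:
  assumes "continuous_on UNIV F" and "\<And>x. F (x + 1) = F x + of_int d"
  shows "is_lift (\<lambda>c. proj_circle (F (rep_circle c))) F"
  unfolding is_lift_def
proof (intro conjI allI)
  fix x
  have "proj_circle x = proj_circle (rep_circle (proj_circle x))"
    by simp
  then obtain m :: int where m: "x = rep_circle (proj_circle x) + of_int m"
    by (rule proj_circle_eqE)
  have "F x = F (rep_circle (proj_circle x)) + of_int (d * m)"
    using degree_add_of_int[of F d, OF assms(2), of "rep_circle (proj_circle x)" m] m by simp
  then show "proj_circle (F x) = proj_circle (F (rep_circle (proj_circle x)))"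
    by (simp only: proj_circle_add_of_int)
qed (rule assms(1))

lemma periodic_bounded:
  fixes g :: "real \<Rightarrow> real"
  assumes cont: "continuous_on UNIV g" and per: "\<And>x. g (x + 1) = g x"
  shows "\<exists>K. \<forall>x. \<bar>g x\<bar> \<le> K"
proof -
  have per_int: "g (x + of_int m) = g x" for x m
    using degree_add_of_int[of g 0 x m] per by simp
  have "compact (g ` {0..1})"
    by (intro compact_continuous_image continuous_on_subset[OF cont]) auto
  then have "bounded (g ` {0..1})"
    by (rule compact_imp_bounded)
  then obtain K where K: "\<forall>y\<in>g ` {0..1}. \<bar>y\<bar> \<le> K"
    unfolding bounded_iff by auto
  have "\<bar>g x\<bar> \<le> K" for x
  proof -
    have "frac x \<in> {0..1}"
      using frac_lt_1[of x] by simp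
    moreover have "g x = g (frac x)"
      using per_int[of "frac x" "\<lfloor>x\<rfloor>"] by (simp add: frac_def)
    ultimately show ?thesis
      using K by simp
  qed
  then show ?thesis
    by blast
qed

lemma lipschitz_if_bounded_derivative:
  fixes g :: "real \<Rightarrow> real"
  assumes "\<And>x. (g has_real_derivative g' x) (at x)" and "\<And>x. \<bar>g' x\<bar> \<le> K"
  shows "\<bar>g x - g y\<bar> \<le> K * \<bar>x - y\<bar>"
  using field_differentiable_bound[of UNIV g g' K x y] assms by simp

section \<open>Circle maps studied through a lift of degree \<open>d\<close>\<close>

locale circle_lift =
  fixes f :: "circle \<Rightarrow> circle" and F :: "real \<Rightarrow> real" and d :: int
  assumes lift: "is_lift f F" and degree: "F (x + 1) = F x + of_int d"
begin

lemma cont: "continuous_on UNIV F"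
  using lift by (simp add: is_lift_def)

lemma proj_lift: "proj_circle (F x) = f (proj_circle x)"
  using lift by (simp add: is_lift_def)

lemma proj_funpow: "proj_circle ((F ^^ n) x) = (f ^^ n) (proj_circle x)"
  by (induction n) (auto simp: proj_lift)

lemma add_of_int: "F (x + of_int m) = F x + of_int (d * m)"
  by (rule degree_add_of_int) (rule degree)

lemma funpow_add_of_int: "(F ^^ n) (x + of_int m) = (F ^^ n) x + of_int (d ^ n * m)"
proof (induction n)
  case (Suc n)
  then show ?case
    using add_of_int[of "(F ^^ n) x" "d ^ n * m"] by (simp add: mult.assoc)
qed simp

lemma cont_funpow: "continuous_on UNIV (F ^^ n)"
  using cont by (rule continuous_on_funpow)

lemma dense_orbit_visits_lift:
  assumes "dense_orbit f (proj_circle x)" "a < b"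
  obtains n p where "n \<ge> N" "a < (F ^^ n) x - of_int p" "(F ^^ n) x - of_int p < b"
proof -
  have "open (proj_circle ` {a<..<b})" "proj_circle ` {a<..<b} \<noteq> {}"
    using assms(2) by (auto intro: open_proj_circle_image)
  from dense_orbit_visits[OF assms(1) this, of N]
  obtain n y where n: "n \<ge> N" and y: "a < y" "y < b" "proj_circle ((F ^^ n) x) = proj_circle y"
    by (auto simp: proj_funpow)
  from y(3) obtain p where "(F ^^ n) x = y + of_int p"
    by (rule proj_circle_eqE)
  with n y(1,2) show ?thesis
    by (intro that[of n p]) auto
qed

text \<open>The iterates of \<open>z\<close> under \<open>G\<close> are monotone and bounded, so a
  subsequence of the circle orbit converges. \<open>G\<close> may include an integer translation,
  and \<open>J\<close> will be an interval between fixed points or a fibre of a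
  semiconjugacy.\<close>

lemma not_dense_orbit_if_mono:
  assumes G: "\<And>x. proj_circle (G x) = (f ^^ n) (proj_circle x)" and n: "n > 0"
    and mono: "mono_on J G" and J: "G ` J \<subseteq> J" "bounded J" "z \<in> J"
  shows "\<not> dense_orbit f (proj_circle z)"
proof -
  have in_J: "(G ^^ k) z \<in> J" for k
    using J by (induction k) auto
  have proj: "proj_circle ((G ^^ k) z) = (f ^^ (n * k)) (proj_circle z)" for k
    by (induction k) (auto simp: G funpow_add)
  have bdd: "Bseq (\<lambda>k. (G ^^ k) z)"
    using J(2) in_J unfolding Bseq_eq_bounded by (auto intro: bounded_subset)
  have "incseq (\<lambda>k. (G ^^ k) z) \<or> decseq (\<lambda>k. (G ^^ k) z)"
  proof (cases "z \<le> G z")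
    case True
    have "(G ^^ k) z \<le> (G ^^ Suc k) z" for k
    proof (induction k)
      case (Suc k)
      then show ?case
        using mono_onD[OF mono in_J in_J, of k "Suc k"] by simp
    qed (simp add: True)
    then show ?thesis
      by (simp add: incseq_Suc_iff)
  next
    case False
    have "(G ^^ Suc k) z \<le> (G ^^ k) z" for k
    proof (induction k)
      case (Suc k)
      then show ?case
        using mono_onD[OF mono in_J in_J, of "Suc k" k] by simp
    qed (use False in simp)
    then show ?thesis
      by (simp add: decseq_Suc_iff)
  qed
  then have "monoseq (\<lambda>k. (G ^^ k) z)"
    by (simp add: monoseq_iff)
  then obtain q where "(\<lambda>k. (G ^^ k) z) \<longlonglongrightarrow> q"
    using Bseq_monoseq_convergent[OF bdd] by (auto simp: convergent_def)
  then have "(\<lambda>k. (f ^^ (n * k)) (proj_circle z)) \<longlonglongrightarrow> proj_circle q"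
    unfolding proj[symmetric]
    by (intro continuous_on_tendsto_compose[OF continuous_on_proj_circle[of UNIV]]) auto
  then show ?thesis
    by (rule not_dense_orbit_if_convergent[OF is_lift_continuous[OF lift] n])
qed

text \<open>Both derivatives have period one and are therefore bounded; \<open>K\<close> serves as a
  common Lipschitz constant for \<open>F\<close> and \<open>F'\<close>.\<close>

lemma C2_lift_bounds:
  assumes "C2_real F"
  obtains F' K where "K > 0" "\<And>x. (F has_real_derivative F' x) (at x)"
    "\<And>x y. \<bar>F x - F y\<bar> \<le> K * \<bar>x - y\<bar>" "\<And>x y. \<bar>F' x - F' y\<bar> \<le> K * \<bar>x - y\<bar>"
proof -
  from assms obtain F' F'' where
    F': "\<And>x. (F has_real_derivative F' x) (at x)" and
    F'': "\<And>x. (F' has_real_derivative F'' x) (at x)" and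
    cont'': "continuous_on UNIV F''"
    unfolding C2_real_def by blast
  have per': "F' (x + 1) = F' x" for x
  proof -
    have "((\<lambda>x. F (x + 1)) has_real_derivative F' (x + 1)) (at x)"
      using F' by (simp flip: DERIV_shift)
    moreover have "((\<lambda>x. F (x + 1)) has_real_derivative F' x) (at x)"
      unfolding degree using F' by (auto intro!: derivative_eq_intros)
    ultimately show ?thesis
      by (rule DERIV_unique)
  qed
  have per'': "F'' (x + 1) = F'' x" for x
  proof -
    have "((\<lambda>x. F' (x + 1)) has_real_derivative F'' (x + 1)) (at x)"
      using F'' by (simp flip: DERIV_shift)
    then show ?thesis
      unfolding per' by (rule DERIV_unique[OF _ F''])
  qed
  have cont': "continuous_on UNIV F'"
    using F'' by (rule DERIV_continuous_on)
  obtain K1 where K1: "\<And>x. \<bar>F' x\<bar> \<le> K1"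
    using periodic_bounded[OF cont' per'] by auto
  obtain K2 where K2: "\<And>x. \<bar>F'' x\<bar> \<le> K2"
    using periodic_bounded[OF cont'' per''] by auto
  define K where "K = max 1 (max K1 K2)"
  show ?thesis
  proof (rule that[of K F'])
    show "\<bar>F x - F y\<bar> \<le> K * \<bar>x - y\<bar>" for x y
      using F' K1 by (intro lipschitz_if_bounded_derivative) (auto simp: K_def le_max_iff_disj)
    show "\<bar>F' x - F' y\<bar> \<le> K * \<bar>x - y\<bar>" for x y
      using F'' K2 by (intro lipschitz_if_bounded_derivative) (auto simp: K_def le_max_iff_disj)
  qed (auto simp: K_def F')
qed

text \<open>The lifted orbit never leaves the sheet of the pseudo-orbit: one step gives a distance
  of at most \<open>K * \<eta> + \<epsilon>\<close>, and up to \<open>1 / 2\<close> the distances on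
  the circle and on the line agree.\<close>

lemma lift_shadowing_orbit:
  assumes lip: "\<And>x y. \<bar>F x - F y\<bar> \<le> K * \<bar>x - y\<bar>" and "K \<ge> 0"
    and pseudo: "\<And>n. \<bar>F (X n) - X (Suc n)\<bar> < \<epsilon>"
    and shadow: "shadowed_by f \<eta> (\<lambda>n. proj_circle (X n)) p"
    and small: "K * \<eta> + \<epsilon> \<le> 1 / 2"
  shows "\<exists>y. \<forall>n. \<bar>(F ^^ n) y - X n\<bar> < \<eta>"
proof -
  have dist: "dist ((f ^^ n) p) (proj_circle (X n)) < \<eta>" for n
    using shadow by (simp add: shadowed_by_def)
  obtain y where y: "proj_circle y = p" "\<bar>y - X 0\<bar> = dist p (proj_circle (X 0))"
    by (rule obtain_near_lift)
  have "\<bar>(F ^^ n) y - X n\<bar> < \<eta>" for n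
  proof (induction n)
    case 0
    then show ?case
      using y(2) dist[of 0] by simp
  next
    case (Suc n)
    have "\<bar>(F ^^ Suc n) y - X (Suc n)\<bar> \<le> \<bar>F ((F ^^ n) y) - F (X n)\<bar> + \<bar>F (X n) - X (Suc n)\<bar>"
      by simp
    also have "\<dots> \<le> K * \<eta> + \<epsilon>"
      using lip[of "(F ^^ n) y" "X n"] pseudo[of n] Suc \<open>K \<ge> 0\<close>
      by (smt (verit) mult_left_mono)
    finally have "dist (proj_circle ((F ^^ Suc n) y)) (proj_circle (X (Suc n)))
        = \<bar>(F ^^ Suc n) y - X (Suc n)\<bar>"
      using small by (intro dist_proj_circle_eq) simp
    then show ?case
      using dist[of "Suc n"] unfolding proj_funpow y(1) by simp
  qed
  then show ?thesis
    by blast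
qed

text \<open>The scale condition of \<open>lift_shadowing_orbit\<close> holds for all small
  \<epsilon> since \<alpha> is positive. The filter form lets further smallness conditions be
  combined with it.\<close>

lemma holder_shadowing_lift:
  assumes "holder_shadowing \<alpha> f" "\<alpha> > 0"
    and lip: "\<And>x y. \<bar>F x - F y\<bar> \<le> K * \<bar>x - y\<bar>" "K \<ge> 0"
  obtains C where "C > 0" "\<forall>\<^sub>F \<epsilon> in at_right 0. \<forall>X. (\<forall>n. \<bar>F (X n) - X (Suc n)\<bar> < \<epsilon>) \<longrightarrow>
    (\<exists>y. \<forall>n. \<bar>(F ^^ n) y - X n\<bar> < C * \<epsilon> powr \<alpha>)"
proof -
  obtain C where C: "C > 0" "\<And>\<epsilon> xs. \<epsilon> > 0 \<Longrightarrow> pseudo_orbit f \<epsilon> xs \<Longrightarrow>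
      \<exists>x. shadowed_by f (C * \<epsilon> powr \<alpha>) xs x"
    using assms(1) unfolding holder_shadowing_def by blast
  have "((\<lambda>\<epsilon>. K * (C * \<epsilon> powr \<alpha>) + \<epsilon>) \<longlongrightarrow> K * (C * 0) + 0) (at_right 0)"
    using assms(2) eventually_at_right_less[of "0::real"]
    by (auto intro!: tendsto_eq_intros elim: eventually_mono)
  then have "\<forall>\<^sub>F \<epsilon> in at_right 0. K * (C * \<epsilon> powr \<alpha>) + \<epsilon> < 1 / 2"
    by (rule order_tendstoD) simp
  moreover have "\<forall>\<^sub>F \<epsilon> in at_right (0::real). \<epsilon> > 0"
    by (rule eventually_at_right_less)
  ultimately have "\<forall>\<^sub>F \<epsilon> in at_right 0. \<forall>X. (\<forall>n. \<bar>F (X n) - X (Suc n)\<bar> < \<epsilon>) \<longrightarrow>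
    (\<exists>y. \<forall>n. \<bar>(F ^^ n) y - X n\<bar> < C * \<epsilon> powr \<alpha>)"
  proof eventually_elim
    case (elim \<epsilon>)
    show ?case
    proof (intro allI impI)
      fix X assume X: "\<forall>n. \<bar>F (X n) - X (Suc n)\<bar> < \<epsilon>"
      have "pseudo_orbit f \<epsilon> (\<lambda>n. proj_circle (X n))"
        unfolding pseudo_orbit_def proj_lift[symmetric]
        using X le_less_trans[OF dist_proj_circle_le] by simp
      then obtain p where "shadowed_by f (C * \<epsilon> powr \<alpha>) (\<lambda>n. proj_circle (X n)) p"
        using C(2) elim(2) by blast
      from lift_shadowing_orbit[OF lip X[rule_format] this less_imp_le[OF elim(1)]]
      show "\<exists>y. \<forall>n. \<bar>(F ^^ n) y - X n\<bar> < C * \<epsilon> powr \<alpha>" .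
    qed
  qed
  with C(1) show ?thesis
    by (rule that)
qed

end

section \<open>Turning points contradict shadowing\<close>

text \<open>The counterpart of \<open>turning_point\<close> for one fixed function on the line, to
  which negation and translation can be applied.\<close>

definition critical_extremum :: "(real \<Rightarrow> real) \<Rightarrow> real \<Rightarrow> bool"
  where "critical_extremum F x \<longleftrightarrow> (F has_real_derivative 0) (at x) \<and>
    ((\<forall>\<^sub>F y in nhds x. F x \<le> F y) \<or> (\<forall>\<^sub>F y in nhds x. F y \<le> F x))"

lemma critical_extremum_uminus: "critical_extremum (\<lambda>x. - F x) c \<longleftrightarrow> critical_extremum F c"
  unfolding critical_extremum_def using DERIV_minus[of F 0 c] DERIV_minus[of "\<lambda>x. - F x" 0 c] by auto

lemma eventually_nhds_add:
  "(\<forall>\<^sub>F y in nhds (x + k). P y) \<longleftrightarrow> (\<forall>\<^sub>F y in nhds x. P (y + k))" for x k :: real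
proof -
  have "nhds (x + k) = filtermap (\<lambda>y. y + k) (nhds x)"
    using filtermap_nhds_shift[of "- k" x] by simp
  then show ?thesis
    by (simp add: eventually_filtermap)
qed

lemma critical_extremum_translate:
  assumes "\<And>x. F (x + k) = F x + b"
  shows "critical_extremum F (x + k) \<longleftrightarrow> critical_extremum F x"
proof -
  have "(F has_real_derivative 0) (at (x + k)) \<longleftrightarrow> ((\<lambda>x. F x + b) has_real_derivative 0) (at x)"
    by (simp add: DERIV_shift assms)
  also have "\<dots> \<longleftrightarrow> (F has_real_derivative 0) (at x)"
    using DERIV_add[OF _ DERIV_const, of F 0 x UNIV b]
      DERIV_add[OF _ DERIV_const, of "\<lambda>x. F x + b" 0 x UNIV "- b"] by auto
  finally show ?thesis
    by (simp add: critical_extremum_def eventually_nhds_add assms)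
qed

lemma critical_extremum_if_locally_constant:
  assumes "\<forall>\<^sub>F y in nhds x. F y = F x"
  shows "critical_extremum F x"
proof -
  have "(F has_real_derivative 0) (at x) \<longleftrightarrow> ((\<lambda>_. F x) has_real_derivative 0) (at x)"
    by (rule DERIV_cong_ev[OF refl assms refl])
  then show ?thesis
    using assms by (auto simp: critical_extremum_def elim: eventually_mono)
qed

text \<open>A value beyond both end values would give an extremum inside the segment, where the
  derivative vanishes. Minima are maxima of \<open>- F\<close>.\<close>

lemma image_segment_without_critical_extremum:
  fixes F :: "real \<Rightarrow> real"
  assumes deriv: "\<And>x. (F has_real_derivative F' x) (at x)"
    and no_crit: "\<And>c. c \<in> closed_segment a b \<Longrightarrow> \<not> critical_extremum F c"
  shows "F ` closed_segment a b \<subseteq> closed_segment (F a) (F b)"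
proof -
  have upper: "G w \<le> max (G a) (G b)"
    if G: "\<And>x. (G has_real_derivative G' x) (at x)"
      and G_crit: "\<And>c. c \<in> closed_segment a b \<Longrightarrow> \<not> critical_extremum G c"
      and w: "w \<in> closed_segment a b" for G G' :: "real \<Rightarrow> real" and w
  proof (rule ccontr)
    assume "\<not> G w \<le> max (G a) (G b)"
    have "continuous_on (closed_segment a b) G"
      using G by (meson DERIV_continuous_on has_field_derivative_at_within)
    from continuous_attains_sup[OF compact_segment _ this]
    obtain p where p: "p \<in> closed_segment a b" "\<And>y. y \<in> closed_segment a b \<Longrightarrow> G y \<le> G p"
      by auto
    have "G w \<le> G p"
      using p(2) w .
    then have "p \<noteq> a" "p \<noteq> b"
      using \<open>\<not> G w \<le> max (G a) (G b)\<close> by auto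
    then have "p \<in> {min a b<..<max a b}"
      using p(1) by (auto simp: closed_segment_eq_real_ivl split: if_splits)
    then have "\<forall>\<^sub>F y in nhds p. y \<in> {min a b<..<max a b}"
      by (intro eventually_nhds_in_open) auto
    then have max: "\<forall>\<^sub>F y in nhds p. G y \<le> G p"
      by eventually_elim (rule p(2), auto simp: closed_segment_eq_real_ivl split: if_splits)
    then obtain r where "r > 0" "\<forall>y. \<bar>p - y\<bar> < r \<longrightarrow> G y \<le> G p"
      by (auto simp: eventually_nhds_metric dist_real_def abs_minus_commute)
    then have "G' p = 0"
      using DERIV_local_max[OF G] by blast
    then have "critical_extremum G p"
      using G[of p] max by (simp add: critical_extremum_def)
    then show False
      using G_crit p(1) by blast
  qed
  have "F w \<in> closed_segment (F a) (F b)" if w: "w \<in> closed_segment a b" for w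
  proof -
    have "F w \<le> max (F a) (F b)"
      using upper[OF deriv no_crit w] .
    moreover have "- F w \<le> max (- F a) (- F b)"
    proof (rule upper[OF _ _ w])
      show "((\<lambda>x. - F x) has_real_derivative - F' x) (at x)" for x
        using deriv by (rule DERIV_minus)
      show "\<not> critical_extremum (\<lambda>x. - F x) c" if "c \<in> closed_segment a b" for c
        using no_crit[OF that] by (simp add: critical_extremum_uminus)
    qed
    ultimately show ?thesis
      by (auto simp: closed_segment_eq_real_ivl max_def split: if_splits)
  qed
  then show ?thesis
    by blast
qed

text \<open>The mean value bound for \<open>F x - F' c * x\<close>, whose derivative is at most
  \<open>K * |w - c|\<close> in absolute value between \<open>c\<close> and \<open>w\<close>. At a
  critical point it makes \<open>F\<close> vary only quadratically.\<close>

lemma taylor_bound: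
  fixes F :: "real \<Rightarrow> real"
  assumes deriv: "\<And>x. (F has_real_derivative F' x) (at x)"
    and lip: "\<And>x y. \<bar>F' x - F' y\<bar> \<le> K * \<bar>x - y\<bar>" and "K \<ge> 0"
  shows "\<bar>F w - F c - F' c * (w - c)\<bar> \<le> K * (w - c)\<^sup>2"
proof -
  define g where "g = (\<lambda>x. F x - F' c * x)"
  have "norm (g w - g c) \<le> (K * \<bar>w - c\<bar>) * norm (w - c)"
  proof (rule field_differentiable_bound[where S = "closed_segment c w" and f' = "\<lambda>x. F' x - F' c"])
    show "(g has_field_derivative F' x - F' c) (at x within closed_segment c w)" for x
      unfolding g_def using deriv[of x]
      by (auto intro!: derivative_eq_intros intro: has_field_derivative_at_within)
    fix x assume "x \<in> closed_segment c w"
    then have "\<bar>x - c\<bar> \<le> \<bar>w - c\<bar>"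
      by (auto simp: closed_segment_eq_real_ivl split: if_splits)
    then show "norm (F' x - F' c) \<le> K * \<bar>w - c\<bar>"
      using lip[of x c] \<open>K \<ge> 0\<close> mult_left_mono[of "\<bar>x - c\<bar>" "\<bar>w - c\<bar>" K] by simp
  qed auto
  then show ?thesis
    by (simp add: g_def algebra_simps power2_eq_square abs_mult_self_eq flip: abs_mult)
qed

text \<open>This is where \<open>\<alpha> > 1/2\<close> is used.\<close>

lemma eventually_powr_small:
  fixes \<alpha> C D :: real
  assumes "\<alpha> > 1 / 2"
  shows "\<forall>\<^sub>F \<epsilon> in at_right 0. D * (sqrt \<epsilon> * (C * \<epsilon> powr \<alpha>) + (C * \<epsilon> powr \<alpha>)\<^sup>2) \<le> \<epsilon> / 8"
proof -
  \<comment> \<open>Dividing the claim by \<epsilon> leaves two powers of \<epsilon> with positive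
    exponents.\<close>
  have "((\<lambda>\<epsilon>. D * (C * \<epsilon> powr (\<alpha> - 1/2) + C\<^sup>2 * \<epsilon> powr (2 * \<alpha> - 1))) \<longlongrightarrow> 0) (at_right 0)"
    using assms eventually_at_right_less[of "0::real"]
    by (auto intro!: tendsto_eq_intros elim: eventually_mono)
  then have "\<forall>\<^sub>F \<epsilon> in at_right 0. D * (C * \<epsilon> powr (\<alpha> - 1/2) + C\<^sup>2 * \<epsilon> powr (2 * \<alpha> - 1)) < 1 / 8"
    by (rule order_tendstoD) simp
  moreover have "\<forall>\<^sub>F \<epsilon> in at_right (0::real). \<epsilon> > 0"
    by (rule eventually_at_right_less)
  ultimately show ?thesis
  proof eventually_elim
    case (elim \<epsilon>)
    have "sqrt \<epsilon> * \<epsilon> powr \<alpha> = \<epsilon> powr (1 + (\<alpha> - 1/2))"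
      using elim(2) by (simp add: powr_half_sqrt[symmetric] flip: powr_add)
    also have "\<dots> = \<epsilon> * \<epsilon> powr (\<alpha> - 1/2)"
      using elim(2) by (subst powr_add) simp
    finally have 1: "sqrt \<epsilon> * \<epsilon> powr \<alpha> = \<epsilon> * \<epsilon> powr (\<alpha> - 1/2)" .
    have "(\<epsilon> powr \<alpha>)\<^sup>2 = \<epsilon> powr (1 + (2 * \<alpha> - 1))"
      by (simp add: power2_eq_square flip: powr_add)
    also have "\<dots> = \<epsilon> * \<epsilon> powr (2 * \<alpha> - 1)"
      using elim(2) by (subst powr_add) simp
    finally have 2: "(\<epsilon> powr \<alpha>)\<^sup>2 = \<epsilon> * \<epsilon> powr (2 * \<alpha> - 1)" .
    have "D * (sqrt \<epsilon> * (C * \<epsilon> powr \<alpha>) + (C * \<epsilon> powr \<alpha>)\<^sup>2)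
        = D * (C * (sqrt \<epsilon> * \<epsilon> powr \<alpha>) + C\<^sup>2 * (\<epsilon> powr \<alpha>)\<^sup>2)"
      by (simp add: power_mult_distrib)
    also have "\<dots> = \<epsilon> * (D * (C * \<epsilon> powr (\<alpha> - 1/2) + C\<^sup>2 * \<epsilon> powr (2 * \<alpha> - 1)))"
      unfolding 1 2 by (simp add: algebra_simps)
    also have "\<dots> \<le> \<epsilon> * (1 / 8)"
      using elim by (intro mult_left_mono) auto
    finally show ?case
      by simp
  qed
qed

text \<open>The witness has \<open>F(x\<^sub>0) = F(c) - \<epsilon>/4\<close>. As \<open>F \<le> F(c)\<close> at \<open>x\<^sub>0 \<plusminus> \<surd>\<epsilon>\<close>,
  \<open>F'(x\<^sub>0) = O(\<surd>\<epsilon>)\<close>, so on the \<open>C\<epsilon>\<^sup>\<alpha>\<close>-neighbourhood of \<open>x\<^sub>0\<close> the map \<open>F\<close> only varies by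
  \<open>o(\<epsilon>)\<close>, while a jump of size less than \<open>\<epsilon>\<close> leads from \<open>F(x\<^sub>0)\<close> beyond the maximal value.\<close>

lemma jump_over_max:
  fixes F :: "real \<Rightarrow> real"
  assumes deriv: "\<And>x. (F has_real_derivative F' x) (at x)"
    and lip: "\<And>x y. \<bar>F' x - F' y\<bar> \<le> K * \<bar>x - y\<bar>" and K: "K \<ge> 0"
    and max: "\<forall>\<^sub>F y in nhds c. F y \<le> F c" and nonconst: "\<not> (\<forall>\<^sub>F y in nhds c. F y = F c)"
    and \<alpha>: "\<alpha> > 1 / 2"
  shows "\<forall>\<^sub>F \<epsilon> in at_right 0. \<exists>x0. \<bar>F x0 - (F c + \<epsilon> / 8)\<bar> < \<epsilon> \<and>
    (\<forall>y. \<bar>y - x0\<bar> < C * \<epsilon> powr \<alpha> \<longrightarrow> F y \<le> F c - \<epsilon> / 8)"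
proof -
  obtain \<rho> where \<rho>: "\<rho> > 0" "\<And>y. \<bar>y - c\<bar> < \<rho> \<Longrightarrow> F y \<le> F c"
    using max by (auto simp: eventually_nhds_metric dist_real_def)
  \<comment> \<open>The radius is halved so that points at distance \<open>sqrt \<epsilon>\<close>
    from \<open>x0\<close> still lie where \<open>F c\<close> is maximal.\<close>
  have "\<exists>z. \<bar>z - c\<bar> < \<rho> / 2 \<and> F z \<noteq> F c"
  proof (rule ccontr)
    assume "\<nexists>z. \<bar>z - c\<bar> < \<rho> / 2 \<and> F z \<noteq> F c"
    then have "\<forall>\<^sub>F y in nhds c. F y = F c"
      using half_gt_zero[OF \<rho>(1)] unfolding eventually_nhds_metric dist_real_def by blast
    then show False
      using nonconst by blast
  qed
  then obtain z where z: "\<bar>z - c\<bar> < \<rho> / 2" "F z \<noteq> F c"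
    by blast
  then have Fz: "F z < F c"
    using \<rho>(2)[of z] \<rho>(1) by force
  have "((\<lambda>\<epsilon>. \<epsilon> / 4) \<longlongrightarrow> 0) (at_right (0::real))"
    by (auto intro!: tendsto_eq_intros)
  then have "\<forall>\<^sub>F \<epsilon> in at_right (0::real). \<epsilon> / 4 < F c - F z"
    by (rule order_tendstoD) (use Fz in simp)
  moreover have "(sqrt \<longlongrightarrow> 0) (at_right (0::real))"
    by (auto intro!: tendsto_eq_intros)
  then have "\<forall>\<^sub>F \<epsilon> in at_right (0::real). sqrt \<epsilon> < \<rho> / 2"
    by (rule order_tendstoD) (use \<rho>(1) in simp)
  moreover have "\<forall>\<^sub>F \<epsilon> in at_right (0::real). \<epsilon> > 0"
    by (rule eventually_at_right_less)
  ultimately show ?thesis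
    using eventually_powr_small[OF \<alpha>, of "K + 1" C]
  proof eventually_elim
    case (elim \<epsilon>)
    define \<eta> where "\<eta> = C * \<epsilon> powr \<alpha>"
    have "continuous_on (closed_segment c z) F"
      using deriv by (meson DERIV_continuous_on has_field_derivative_at_within)
    then have "connected (F ` closed_segment c z)"
      by (intro connected_continuous_image) auto
    from connected_contains_Icc[OF this, of "F z" "F c"]
    have "F c - \<epsilon> / 4 \<in> F ` closed_segment c z"
      using elim(1,3) by auto
    then obtain x0 where x0: "x0 \<in> closed_segment c z" "F x0 = F c - \<epsilon> / 4"
      by auto
    have x0_near: "\<bar>x0 - c\<bar> < \<rho> / 2"
      using x0(1) z(1) by (auto simp: closed_segment_eq_real_ivl split: if_splits)
    have D: "\<bar>F' x0\<bar> \<le> (K + 1) * sqrt \<epsilon>"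
    proof -
      \<comment> \<open>This sign makes \<open>F' x0 * t\<close> nonnegative. Since \<open>F\<close>
        rises by at most \<open>\<epsilon> / 4\<close> from \<open>x0\<close> to
        \<open>x0 + t\<close>, the Taylor bound then controls \<open>F' x0\<close>.\<close>
      define t where "t = (if F' x0 \<ge> 0 then sqrt \<epsilon> else - sqrt \<epsilon>)"
      have t: "\<bar>t\<bar> = sqrt \<epsilon>" "t\<^sup>2 = \<epsilon>" "F' x0 * t = \<bar>F' x0\<bar> * sqrt \<epsilon>"
        using elim(3) by (auto simp: t_def)
      have "F (x0 + t) \<le> F c"
        using x0_near t(1) elim(2) by (intro \<rho>(2)) linarith
      moreover have "\<bar>F (x0 + t) - F x0 - F' x0 * t\<bar> \<le> K * \<epsilon>"
        using taylor_bound[OF deriv lip K, of "x0 + t" x0] t(2) by simp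
      ultimately have "\<bar>F' x0\<bar> * sqrt \<epsilon> \<le> (K + 1) * \<epsilon>"
        using x0(2) elim(3) t(3) unfolding distrib_right by linarith
      also have "\<dots> = ((K + 1) * sqrt \<epsilon>) * sqrt \<epsilon>"
        using elim(3) by simp
      finally show ?thesis
        using elim(3) by (simp only: mult_le_cancel_right_pos real_sqrt_gt_zero)
    qed
    have "F y \<le> F c - \<epsilon> / 8" if y: "\<bar>y - x0\<bar> < \<eta>" for y
    proof -
      have "\<bar>F y - F x0 - F' x0 * (y - x0)\<bar> \<le> K * (y - x0)\<^sup>2"
        using taylor_bound[OF deriv lip K] .
      moreover have "K * (y - x0)\<^sup>2 \<le> (K + 1) * \<eta>\<^sup>2"
        using y K by (intro mult_mono) (auto simp: abs_le_square_iff[symmetric])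
      moreover have "\<bar>F' x0 * (y - x0)\<bar> \<le> ((K + 1) * sqrt \<epsilon>) * \<eta>"
        unfolding abs_mult using y D K elim(3) by (intro mult_mono) auto
      moreover have "(K + 1) * sqrt \<epsilon> * \<eta> + (K + 1) * \<eta>\<^sup>2 \<le> \<epsilon> / 8"
        using elim(4) by (simp add: \<eta>_def algebra_simps)
      ultimately show ?thesis
        using x0(2) by linarith
    qed
    then show ?case
      using x0(2) elim(3) unfolding \<eta>_def by (intro exI[of _ x0]) auto
  qed
qed

text \<open>The jump from \<open>F x0\<close> to \<open>x1\<close> will be the only error of a
  pseudo-orbit, and \<open>y\<close> the start of an orbit shadowing it. Segments treat maxima and
  minima alike.\<close>

definition jumps_across :: "(real \<Rightarrow> real) \<Rightarrow> real \<Rightarrow> real \<Rightarrow> real \<Rightarrow> bool"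
  where "jumps_across F \<epsilon> \<eta> c \<longleftrightarrow> (\<exists>x0 x1. \<bar>F x0 - x1\<bar> < \<epsilon> \<and>
    (\<forall>y. \<bar>y - x0\<bar> < \<eta> \<longrightarrow> {F c - \<epsilon> / 8..F c + \<epsilon> / 8} \<subseteq> closed_segment (F y) x1))"

text \<open>At a maximum the target is \<open>x1 = F c + \<epsilon> / 8\<close>. At a minimum the
  same argument for \<open>- F\<close> gives \<open>x1 = F c - \<epsilon> / 8\<close>.\<close>

lemma eventually_jumps_across:
  fixes F :: "real \<Rightarrow> real"
  assumes deriv: "\<And>x. (F has_real_derivative F' x) (at x)"
    and lip: "\<And>x y. \<bar>F' x - F' y\<bar> \<le> K * \<bar>x - y\<bar>" and K: "K \<ge> 0"
    and crit: "critical_extremum F c" and nonconst: "\<not> (\<forall>\<^sub>F y in nhds c. F y = F c)"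
    and \<alpha>: "\<alpha> > 1 / 2"
  shows "\<forall>\<^sub>F \<epsilon> in at_right 0. jumps_across F \<epsilon> (C * \<epsilon> powr \<alpha>) c"
proof -
  have pos: "\<forall>\<^sub>F \<epsilon> in at_right (0::real). \<epsilon> > 0"
    by (rule eventually_at_right_less)
  consider "\<forall>\<^sub>F y in nhds c. F y \<le> F c" | "\<forall>\<^sub>F y in nhds c. F c \<le> F y"
    using crit by (auto simp: critical_extremum_def)
  then show ?thesis
  proof cases
    case 1
    from jump_over_max[OF deriv lip K 1 nonconst \<alpha>, of C] pos show ?thesis
    proof eventually_elim
      case (elim \<epsilon>)
      then obtain x0 where x0: "\<bar>F x0 - (F c + \<epsilon> / 8)\<bar> < \<epsilon>"
        "\<And>y. \<bar>y - x0\<bar> < C * \<epsilon> powr \<alpha> \<Longrightarrow> F y \<le> F c - \<epsilon> / 8"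
        by blast
      show ?case
        unfolding jumps_across_def
      proof (intro exI conjI allI impI)
        show "{F c - \<epsilon> / 8..F c + \<epsilon> / 8} \<subseteq> closed_segment (F y) (F c + \<epsilon> / 8)"
          if "\<bar>y - x0\<bar> < C * \<epsilon> powr \<alpha>" for y
          using x0(2)[OF that] elim(2) by (auto simp: closed_segment_eq_real_ivl)
      qed (rule x0(1))
    qed
  next
    case 2
    have "\<forall>\<^sub>F y in nhds c. - F y \<le> - F c" "\<not> (\<forall>\<^sub>F y in nhds c. - F y = - F c)"
      using 2 nonconst by simp_all
    moreover have "((\<lambda>x. - F x) has_real_derivative - F' x) (at x)" for x
      using deriv by (rule DERIV_minus)
    moreover have "\<bar>- F' x - - F' y\<bar> \<le> K * \<bar>x - y\<bar>" for x y
      using lip[of x y] by (simp add: abs_minus_commute)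
    ultimately have "\<forall>\<^sub>F \<epsilon> in at_right 0. \<exists>x0. \<bar>- F x0 - (- F c + \<epsilon> / 8)\<bar> < \<epsilon> \<and>
        (\<forall>y. \<bar>y - x0\<bar> < C * \<epsilon> powr \<alpha> \<longrightarrow> - F y \<le> - F c - \<epsilon> / 8)"
      using jump_over_max[of "\<lambda>x. - F x" "\<lambda>x. - F' x" K c \<alpha> C] K \<alpha> by blast
    from this pos show ?thesis
    proof eventually_elim
      case (elim \<epsilon>)
      then obtain x0 where x0: "\<bar>- F x0 - (- F c + \<epsilon> / 8)\<bar> < \<epsilon>"
        "\<And>y. \<bar>y - x0\<bar> < C * \<epsilon> powr \<alpha> \<Longrightarrow> - F y \<le> - F c - \<epsilon> / 8"
        by blast
      show ?case
        unfolding jumps_across_def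
      proof (intro exI conjI allI impI)
        show "\<bar>F x0 - (F c - \<epsilon> / 8)\<bar> < \<epsilon>"
          using x0(1) by linarith
        show "{F c - \<epsilon> / 8..F c + \<epsilon> / 8} \<subseteq> closed_segment (F y) (F c - \<epsilon> / 8)"
          if "\<bar>y - x0\<bar> < C * \<epsilon> powr \<alpha>" for y
          using x0(2)[OF that] elim(2) by (auto simp: closed_segment_eq_real_ivl)
      qed
    qed
  qed
qed

text \<open>The segments between the jumping pseudo-orbit and the orbit shadowing it are mapped onto
  each other until one of them contains another critical point; then the \<open>\<epsilon>/8\<close>-neighbourhood of
  the old critical value has been mapped into that of the new one, since \<open>K \<eta>\<^sup>2 \<le> \<epsilon>/8\<close>.\<close>

lemma critical_values_stable:
  fixes F :: "real \<Rightarrow> real"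
  assumes deriv: "\<And>x. (F has_real_derivative F' x) (at x)"
    and lip: "\<And>x y. \<bar>F' x - F' y\<bar> \<le> K * \<bar>x - y\<bar>" and K: "K \<ge> 0"
    and shadowing: "\<And>X. (\<And>n. \<bar>F (X n) - X (Suc n)\<bar> < \<epsilon>) \<Longrightarrow> \<exists>y. \<forall>n. \<bar>(F ^^ n) y - X n\<bar> < \<eta>"
    and jumps: "\<And>c. critical_extremum F c \<Longrightarrow> jumps_across F \<epsilon> \<eta> c"
    and \<epsilon>: "\<epsilon> > 0" and small: "K * \<eta>\<^sup>2 \<le> \<epsilon> / 8"
    and "critical_extremum F c"
    and "u \<in> {F c - \<epsilon> / 8..F c + \<epsilon> / 8}" "v \<in> {F c - \<epsilon> / 8..F c + \<epsilon> / 8}"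
  shows "\<bar>(F ^^ i) u - (F ^^ i) v\<bar> \<le> \<eta>"
  using assms(8-)
proof (induction i arbitrary: c u v rule: less_induct)
  case (less i)
  define V where "V = {F c - \<epsilon> / 8..F c + \<epsilon> / 8}"
  from jumps[OF less.prems(1)] obtain x0 x1 where x01: "\<bar>F x0 - x1\<bar> < \<epsilon>"
    "\<And>y. \<bar>y - x0\<bar> < \<eta> \<Longrightarrow> V \<subseteq> closed_segment (F y) x1"
    unfolding jumps_across_def V_def by blast
  \<comment> \<open>After the initial jump \<open>X\<close> is the true orbit of
    \<open>x1\<close>.\<close>
  define X where "X = (\<lambda>n. case n of 0 \<Rightarrow> x0 | Suc m \<Rightarrow> (F ^^ m) x1)"
  have "\<bar>F (X n) - X (Suc n)\<bar> < \<epsilon>" for n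
    using x01(1) \<epsilon> by (cases n) (auto simp: X_def)
  from shadowing[of X, OF this] obtain y where y: "\<And>n. \<bar>(F ^^ n) y - X n\<bar> < \<eta>"
    by blast
  \<comment> \<open>\<open>X (Suc j)\<close> is the \<open>j\<close>-th iterate of
    \<open>x1\<close>, so both ends of \<open>S j\<close> belong to time
    \<open>j + 1\<close>.\<close>
  define S where "S = (\<lambda>j. closed_segment ((F ^^ Suc j) y) ((F ^^ j) x1))"
  have S_small: "\<bar>a - b\<bar> \<le> \<eta>" if "a \<in> S j" "b \<in> S j" for a b j
    using that y[of "Suc j"] by (auto simp: S_def X_def closed_segment_eq_real_ivl split: if_splits)
  have "V \<subseteq> S 0"
    using x01(2)[of y] y[of 0] by (simp add: S_def X_def)
  have V_S: "(F ^^ j) w \<in> S j" if "w \<in> V" "\<forall>l<j. \<forall>c'\<in>S l. \<not> critical_extremum F c'" for j w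
    using that(2)
  proof (induction j)
    case 0
    then show ?case
      using \<open>V \<subseteq> S 0\<close> that(1) by auto
  next
    case (Suc j)
    have "F ` closed_segment ((F ^^ Suc j) y) ((F ^^ j) x1)
        \<subseteq> closed_segment (F ((F ^^ Suc j) y)) (F ((F ^^ j) x1))"
      using Suc.prems by (intro image_segment_without_critical_extremum[OF deriv]) (auto simp: S_def)
    moreover have "(F ^^ j) w \<in> S j"
      using Suc.prems less_SucI by (intro Suc.IH) blast
    ultimately show ?case
      by (auto simp: S_def)
  qed
  have uv: "u \<in> V" "v \<in> V"
    using less.prems by (simp_all add: V_def)
  show ?case
  proof (cases "\<exists>l<i. \<exists>c'\<in>S l. critical_extremum F c'")
    case False
    then have "(F ^^ i) u \<in> S i" "(F ^^ i) v \<in> S i"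
      using V_S[OF uv(1)] V_S[OF uv(2)] by auto
    then show ?thesis
      by (rule S_small)
  next
    case True
    define N where "N = (LEAST l. \<exists>c'\<in>S l. critical_extremum F c')"
    have N: "N < i" "\<exists>c'\<in>S N. critical_extremum F c'"
      using True LeastI_ex[of "\<lambda>l. \<exists>c'\<in>S l. critical_extremum F c'"]
        Least_le[of "\<lambda>l. \<exists>c'\<in>S l. critical_extremum F c'"] le_less_trans
      unfolding N_def by blast+
    have before_N: "\<forall>l<N. \<forall>c'\<in>S l. \<not> critical_extremum F c'"
      unfolding N_def using not_less_Least[of _ "\<lambda>l. \<exists>c'\<in>S l. critical_extremum F c'"] by blast
    obtain c' where c': "c' \<in> S N" "critical_extremum F c'"
      using N(2) by blast
    then have "F' c' = 0"
      using DERIV_unique[OF deriv] by (auto simp: critical_extremum_def)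
    have near: "(F ^^ Suc N) w \<in> {F c' - \<epsilon> / 8..F c' + \<epsilon> / 8}" if "w \<in> V" for w
    proof -
      have "\<bar>(F ^^ N) w - c'\<bar> \<le> \<eta>"
        using S_small[OF V_S[OF that before_N] c'(1)] .
      then have "((F ^^ N) w - c')\<^sup>2 \<le> \<eta>\<^sup>2"
        by (simp add: abs_le_square_iff[symmetric])
      then have "K * ((F ^^ N) w - c')\<^sup>2 \<le> \<epsilon> / 8"
        using order_trans[OF mult_left_mono[OF _ K] small] by simp
      then show ?thesis
        using taylor_bound[OF deriv lip K, of "(F ^^ N) w" c'] \<open>F' c' = 0\<close> by (simp add: abs_le_iff)
    qed
    \<comment> \<open>Passing from \<open>c\<close> to \<open>c'\<close> consumes
      \<open>Suc N\<close> steps, so the induction hypothesis covers the remaining time.\<close>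
    have "(F ^^ i) w = (F ^^ (i - Suc N)) ((F ^^ Suc N) w)" for w
      using N(1) by (simp flip: funpow_add comp_apply[of "F ^^ (i - Suc N)"] del: funpow.simps)
    then show ?thesis
      using less.IH[OF _ c'(2) near[OF uv(1)] near[OF uv(2)], of "i - Suc N"] N(1) by simp
  qed
qed

section \<open>Turning points of circle maps\<close>

context circle_lift
begin

text \<open>Two lifts differ by a constant and two preimages by an integer; neither change affects
  critical extrema.\<close>

lemma turning_point_iff: "turning_point f (proj_circle x) \<longleftrightarrow> critical_extremum F x"
proof
  assume "turning_point f (proj_circle x)"
  then obtain G x' where G: "is_lift f G" "proj_circle x' = proj_circle x" "critical_extremum G x'"
    unfolding turning_point_def critical_extremum_def by blast
  obtain m :: int where m: "\<And>x. F x = G x + of_int m"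
    using is_lift_diff[OF G(1) lift] by blast
  obtain k :: int where k: "x = x' + of_int k"
    using G(2) proj_circle_eqE by metis
  have "critical_extremum F x'"
  proof -
    have "(G has_real_derivative 0) (at x')"
      using G(3) by (simp add: critical_extremum_def)
    then have "(F has_real_derivative 0) (at x')"
      unfolding m[abs_def] by (auto intro!: derivative_eq_intros)
    then show ?thesis
      using G(3) by (simp add: critical_extremum_def m)
  qed
  then show "critical_extremum F x"
    unfolding k using critical_extremum_translate[of F "of_int k" "of_int (d * k)", OF add_of_int] by simp
next
  assume "critical_extremum F x"
  then show "turning_point f (proj_circle x)"
    unfolding turning_point_def critical_extremum_def using lift by blast
qed

text \<open>On an interval shorter than one turn injectivity passes to \<open>F\<close>, and a
  continuous injective function there is strictly monotone.\<close>

lemma not_critical_extremum_if_inj: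
  assumes "inj f"
  shows "\<not> critical_extremum F c"
proof
  assume crit: "critical_extremum F c"
  have "inj_on F {c - 1/4..c + 1/4}"
  proof (rule inj_onI)
    fix x y assume xy: "x \<in> {c - 1/4..c + 1/4}" "y \<in> {c - 1/4..c + 1/4}" "F x = F y"
    then have "proj_circle x = proj_circle y"
      using assms by (metis injD proj_lift)
    then show "x = y"
      using xy(1,2) by (intro inj_onD[OF inj_on_proj_circle[of "c - 1/4"]]) auto
  qed
  obtain r where r: "r > 0" "(\<forall>y. \<bar>y - c\<bar> < r \<longrightarrow> F c \<le> F y) \<or> (\<forall>y. \<bar>y - c\<bar> < r \<longrightarrow> F y \<le> F c)"
    using crit unfolding critical_extremum_def eventually_nhds_metric dist_real_def by auto
  define \<delta> where "\<delta> = min (r / 2) (1 / 4)"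
  have \<delta>: "\<delta> > 0" "\<delta> < r" "\<delta> \<le> 1 / 4"
    using r(1) by (auto simp: \<delta>_def)
  have "F (c - \<delta>) < F c \<and> F c < F (c + \<delta>) \<or> F (c + \<delta>) < F c \<and> F c < F (c - \<delta>)"
  proof (rule continuous_inj_imp_mono[where f = F and x = c])
    show "continuous_on {c - \<delta>..c + \<delta>} F"
      using cont by (rule continuous_on_subset) simp
    show "inj_on F {c - \<delta>..c + \<delta>}"
      using \<open>inj_on F {c - 1/4..c + 1/4}\<close> by (rule inj_on_subset) (use \<delta>(3) in auto)
  qed (use \<delta> in auto)
  moreover have "\<bar>(c - \<delta>) - c\<bar> < r" "\<bar>(c + \<delta>) - c\<bar> < r"
    using \<delta> by auto
  ultimately show False
    using r(2) by (metis linorder_not_less)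
qed

text \<open>Every point of a flat piece is a critical extremum, which would give infinitely many
  turning points.\<close>

lemma not_locally_constant:
  assumes fin: "finite {c. turning_point f c}"
  shows "\<not> (\<forall>\<^sub>F y in nhds c. F y = F c)"
proof
  assume "\<forall>\<^sub>F y in nhds c. F y = F c"
  then obtain r where r: "r > 0" "\<And>y. \<bar>y - c\<bar> < r \<Longrightarrow> F y = F c"
    by (auto simp: eventually_nhds_metric dist_real_def)
  define I where "I = {c<..<c + min r 1}"
  have "critical_extremum F x" if x: "x \<in> I" for x
  proof -
    have "\<forall>\<^sub>F y in nhds x. y \<in> I"
      using x by (intro eventually_nhds_in_open) (auto simp: I_def)
    then have "\<forall>\<^sub>F y in nhds x. F y = F x"
    proof eventually_elim
      case (elim y)
      then show ?case
        using r(2)[of x] r(2)[of y] x unfolding I_def by auto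
    qed
    then show ?thesis
      by (rule critical_extremum_if_locally_constant)
  qed
  then have "proj_circle ` I \<subseteq> {c. turning_point f c}"
    by (auto simp: turning_point_iff)
  then have "finite (proj_circle ` I)"
    using fin finite_subset by blast
  moreover have "inj_on proj_circle I"
    by (rule inj_on_subset[OF inj_on_proj_circle[of c]]) (auto simp: I_def)
  ultimately have "finite I"
    by (simp add: finite_image_iff)
  then show False
    using r(1) infinite_Ioo[of c "c + min r 1"] by (simp add: I_def)
qed

text \<open>Jumps need checking only at one representative of each turning point; finiteness then
  gives a common range of \<epsilon>.\<close>

lemma jumps_across_translate:
  assumes "jumps_across F \<epsilon> \<eta> c"
  shows "jumps_across F \<epsilon> \<eta> (c + of_int m)"
proof -
  from assms obtain x0 x1 where x01: "\<bar>F x0 - x1\<bar> < \<epsilon>"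
    "\<And>y. \<bar>y - x0\<bar> < \<eta> \<Longrightarrow> {F c - \<epsilon> / 8..F c + \<epsilon> / 8} \<subseteq> closed_segment (F y) x1"
    unfolding jumps_across_def by blast
  define b where "b = real_of_int (d * m)"
  have F: "F (x + of_int m) = F x + b" for x
    by (simp add: b_def add_of_int)
  have "{F (c + of_int m) - \<epsilon> / 8..F (c + of_int m) + \<epsilon> / 8} \<subseteq> closed_segment (F y) (x1 + b)"
    if "\<bar>y - (x0 + of_int m)\<bar> < \<eta>" for y
  proof
    fix w assume w: "w \<in> {F (c + of_int m) - \<epsilon> / 8..F (c + of_int m) + \<epsilon> / 8}"
    have "\<bar>(y - of_int m) - x0\<bar> < \<eta>"
      using that by (simp add: algebra_simps)
    from x01(2)[OF this] have "w - b \<in> closed_segment (F (y - of_int m)) x1"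
      using w by (auto simp: F)
    then show "w \<in> closed_segment (F y) (x1 + b)"
      using F[of "y - of_int m"] by (auto simp: closed_segment_eq_real_ivl split: if_splits)
  qed
  moreover have "\<bar>F (x0 + of_int m) - (x1 + b)\<bar> < \<epsilon>"
    using x01(1) by (simp add: F)
  ultimately show ?thesis
    unfolding jumps_across_def by blast
qed

text \<open>At a suitable small \<epsilon> all iterates keep the arc around the critical value
  short. Such arcs contradict sensitivity, so \<open>f\<close> is injective and has no
  extremum.\<close>

theorem no_critical_extremum_if_shadowing:
  assumes C2: "C2_real F" and fin: "finite {c. turning_point f c}"
    and dense: "dense_orbit f z" and \<alpha>: "\<alpha> > 1 / 2" and shadowing: "holder_shadowing \<alpha> f"
  shows "\<not> critical_extremum F c"
proof
  assume crit: "critical_extremum F c"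
  from C2_lift_bounds[OF C2] obtain F' K where K: "K > 0"
    and deriv: "\<And>x. (F has_real_derivative F' x) (at x)"
    and lipF: "\<And>x y. \<bar>F x - F y\<bar> \<le> K * \<bar>x - y\<bar>"
    and lip: "\<And>x y. \<bar>F' x - F' y\<bar> \<le> K * \<bar>x - y\<bar>"
    by metis
  from K have K0: "K \<ge> 0"
    by simp
  have "\<alpha> > 0"
    using \<alpha> by simp
  from holder_shadowing_lift[OF shadowing this lipF K0] obtain C where C: "C > 0" and
    shad: "\<forall>\<^sub>F \<epsilon> in at_right 0. \<forall>X. (\<forall>n. \<bar>F (X n) - X (Suc n)\<bar> < \<epsilon>) \<longrightarrow>
      (\<exists>y. \<forall>n. \<bar>(F ^^ n) y - X n\<bar> < C * \<epsilon> powr \<alpha>)" .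
  have "\<forall>\<^sub>F \<epsilon> in at_right 0. \<forall>t\<in>{c. turning_point f c}. jumps_across F \<epsilon> (C * \<epsilon> powr \<alpha>) (rep_circle t)"
  proof (intro eventually_ball_finite fin ballI)
    fix t assume "t \<in> {c. turning_point f c}"
    then have "critical_extremum F (rep_circle t)"
      by (simp flip: turning_point_iff)
    then show "\<forall>\<^sub>F \<epsilon> in at_right 0. jumps_across F \<epsilon> (C * \<epsilon> powr \<alpha>) (rep_circle t)"
      using eventually_jumps_across[OF deriv lip K0 _ not_locally_constant[OF fin] \<alpha>] by blast
  qed
  then have jumps: "\<forall>\<^sub>F \<epsilon> in at_right 0. \<forall>c. critical_extremum F c \<longrightarrow> jumps_across F \<epsilon> (C * \<epsilon> powr \<alpha>) c"
  proof eventually_elim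
    case (elim \<epsilon>)
    show ?case
    proof (intro allI impI)
      fix c assume "critical_extremum F c"
      then have "turning_point f (proj_circle c)"
        by (simp add: turning_point_iff)
      with elim have "jumps_across F \<epsilon> (C * \<epsilon> powr \<alpha>) (rep_circle (proj_circle c))"
        by blast
      moreover have "proj_circle c = proj_circle (rep_circle (proj_circle c))"
        by simp
      then obtain m :: int where "c = rep_circle (proj_circle c) + of_int m"
        by (rule proj_circle_eqE)
      ultimately show "jumps_across F \<epsilon> (C * \<epsilon> powr \<alpha>) c"
        using jumps_across_translate by metis
    qed
  qed
  have "inj f"
  proof (rule inj_if_transitive_not_sensitive[OF is_lift_continuous[OF lift] dense])
    fix \<eta>0 :: real assume "\<eta>0 > 0"
    have "((\<lambda>\<epsilon>. C * \<epsilon> powr \<alpha>) \<longlongrightarrow> 0) (at_right 0)"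
      using \<alpha> eventually_at_right_less[of "0::real"]
      by (auto intro!: tendsto_eq_intros elim: eventually_mono)
    then have "\<forall>\<^sub>F \<epsilon> in at_right 0. C * \<epsilon> powr \<alpha> < \<eta>0"
      using \<open>\<eta>0 > 0\<close> by (rule order_tendstoD)
    moreover have "\<forall>\<^sub>F \<epsilon> in at_right (0::real). \<epsilon> > 0"
      by (rule eventually_at_right_less)
    ultimately have "\<forall>\<^sub>F \<epsilon> in at_right 0. C * \<epsilon> powr \<alpha> < \<eta>0 \<and> \<epsilon> > 0 \<and>
        (\<forall>c. critical_extremum F c \<longrightarrow> jumps_across F \<epsilon> (C * \<epsilon> powr \<alpha>) c) \<and>
        (\<forall>X. (\<forall>n. \<bar>F (X n) - X (Suc n)\<bar> < \<epsilon>) \<longrightarrow> (\<exists>y. \<forall>n. \<bar>(F ^^ n) y - X n\<bar> < C * \<epsilon> powr \<alpha>)) \<and>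
        K * (sqrt \<epsilon> * (C * \<epsilon> powr \<alpha>) + (C * \<epsilon> powr \<alpha>)\<^sup>2) \<le> \<epsilon> / 8"
      using jumps shad eventually_powr_small[OF \<alpha>, of K C] by (intro eventually_conj)
    from eventually_happens'[OF trivial_limit_at_right_real this]
    obtain \<epsilon> where \<epsilon>: "C * \<epsilon> powr \<alpha> < \<eta>0" "\<epsilon> > 0"
      "\<And>c. critical_extremum F c \<Longrightarrow> jumps_across F \<epsilon> (C * \<epsilon> powr \<alpha>) c"
      "\<And>X. (\<forall>n. \<bar>F (X n) - X (Suc n)\<bar> < \<epsilon>) \<longrightarrow> (\<exists>y. \<forall>n. \<bar>(F ^^ n) y - X n\<bar> < C * \<epsilon> powr \<alpha>)"
      "K * (sqrt \<epsilon> * (C * \<epsilon> powr \<alpha>) + (C * \<epsilon> powr \<alpha>)\<^sup>2) \<le> \<epsilon> / 8"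
      by auto
    define \<eta> where "\<eta> = C * \<epsilon> powr \<alpha>"
    define I where "I = {F c - \<epsilon> / 8<..<F c + \<epsilon> / 8}"
    have "K * \<eta>\<^sup>2 \<le> \<epsilon> / 8"
    proof -
      have "K * \<eta>\<^sup>2 \<le> K * (sqrt \<epsilon> * \<eta> + \<eta>\<^sup>2)"
        using C \<epsilon>(2) K by (intro mult_left_mono) (auto simp: \<eta>_def)
      then show ?thesis
        using \<epsilon>(5) by (simp add: \<eta>_def)
    qed
    have stable: "\<bar>(F ^^ i) u - (F ^^ i) v\<bar> \<le> \<eta>" if "u \<in> I" "v \<in> I" for i u v
    proof (rule critical_values_stable[OF deriv lip K0])
      show "\<exists>y. \<forall>n. \<bar>(F ^^ n) y - X n\<bar> < \<eta>" if "\<And>n. \<bar>F (X n) - X (Suc n)\<bar> < \<epsilon>" for X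
        using \<epsilon>(4) that by (simp add: \<eta>_def)
      show "jumps_across F \<epsilon> \<eta> c" if "critical_extremum F c" for c
        using \<epsilon>(3) that by (simp add: \<eta>_def)
      show "u \<in> {F c - \<epsilon> / 8..F c + \<epsilon> / 8}" "v \<in> {F c - \<epsilon> / 8..F c + \<epsilon> / 8}"
        using that by (auto simp: I_def)
    qed (use \<epsilon>(2) \<open>K * \<eta>\<^sup>2 \<le> \<epsilon> / 8\<close> crit in auto)
    show "\<exists>U. open U \<and> U \<noteq> {} \<and> (\<forall>i. \<forall>u\<in>U. \<forall>v\<in>U. dist ((f ^^ i) u) ((f ^^ i) v) \<le> \<eta>0)"
    proof (intro exI conjI allI ballI)
      show "open (proj_circle ` I)"
        by (intro open_proj_circle_image) (simp add: I_def)
      show "proj_circle ` I \<noteq> {}"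
        using \<epsilon>(2) by (simp add: I_def)
      fix i a b assume "a \<in> proj_circle ` I" "b \<in> proj_circle ` I"
      then obtain u v where uv: "u \<in> I" "v \<in> I" "a = proj_circle u" "b = proj_circle v"
        by blast
      have "dist ((f ^^ i) a) ((f ^^ i) b) \<le> \<bar>(F ^^ i) u - (F ^^ i) v\<bar>"
        unfolding uv proj_funpow[symmetric] by (rule dist_proj_circle_le)
      also have "\<dots> \<le> \<eta>"
        using stable uv(1,2) .
      also have "\<dots> \<le> \<eta>0"
        using \<epsilon>(1) by (simp add: \<eta>_def)
      finally show "dist ((f ^^ i) a) ((f ^^ i) b) \<le> \<eta>0" .
    qed
  qed
  then show False
    using not_critical_extremum_if_inj crit by blast
qed

end

section \<open>Monotone lifts\<close>

lemma ex_lift_in_unit_interval: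
  obtains x where "proj_circle x = c" "a \<le> x" "x < a + 1"
proof
  define y where "y = rep_circle c"
  show "proj_circle (y - of_int \<lfloor>y - a\<rfloor>) = c"
    by (simp add: y_def)
  show "a \<le> y - of_int \<lfloor>y - a\<rfloor>" "y - of_int \<lfloor>y - a\<rfloor> < a + 1"
    by linarith+
qed

text \<open>The intermediate value theorem for \<open>G x - x\<close>; \<open>a\<close> and
  \<open>b\<close> may come in either order.\<close>

lemma fixed_point_between:
  fixes G :: "real \<Rightarrow> real"
  assumes cont: "continuous_on UNIV G" and "G a \<le> a" "b \<le> G b"
  obtains w where "G w = w"
proof -
  have "connected ((\<lambda>x. G x - x) ` UNIV)"
    by (intro connected_continuous_image continuous_on_diff cont continuous_on_id) auto
  from connected_contains_Icc[OF this, of "G a - a" "G b - b"]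
  have "0 \<in> (\<lambda>x. G x - x) ` UNIV"
    using assms(2,3) by auto
  then obtain w where "0 = G w - w"
    by blast
  then show ?thesis
    by (intro that[of w]) simp
qed

context circle_lift
begin

text \<open>If \<open>F a = F b\<close>, the image of the segment collapses to a point, and the
  midpoint of a flat piece is critical.\<close>

lemma inj_if_no_critical_extremum:
  assumes deriv: "\<And>x. (F has_real_derivative F' x) (at x)"
    and no_crit: "\<And>c. \<not> critical_extremum F c"
  shows "inj F"
proof -
  have neq: "F a \<noteq> F b" if "a < b" for a b
  proof
    assume "F a = F b"
    define m where "m = (a + b) / 2"
    have const: "F y = F m" if "y \<in> {a<..<b}" for y
    proof -
      have "F ` closed_segment a b \<subseteq> {F a}"
        using image_segment_without_critical_extremum[OF deriv no_crit, of a b] \<open>F a = F b\<close> by simp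
      moreover have "y \<in> closed_segment a b" "m \<in> closed_segment a b"
        using that \<open>a < b\<close> by (auto simp: closed_segment_eq_real_ivl m_def)
      ultimately have "F y \<in> {F a}" "F m \<in> {F a}"
        by blast+
      then show ?thesis
        by simp
    qed
    have "\<forall>\<^sub>F y in nhds m. y \<in> {a<..<b}"
      using \<open>a < b\<close> by (intro eventually_nhds_in_open) (auto simp: m_def)
    then have ev: "\<forall>\<^sub>F y in nhds m. F y = F m"
      by eventually_elim (rule const)
    then have "critical_extremum F m"
      by (rule critical_extremum_if_locally_constant)
    with no_crit show False
      by blast
  qed
  show ?thesis
  proof (rule injI, rule ccontr)
    fix a b assume "F a = F b" "a \<noteq> b"
    then show False
      using neq[of a b] neq[of b a] by (cases a b rule: linorder_cases) auto
  qed
qed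

lemma monotone_cases:
  assumes "inj F"
  obtains "d \<ge> 1" "\<And>x y. x < y \<Longrightarrow> F x < F y" | "d \<le> - 1" "\<And>x y. x < y \<Longrightarrow> F y < F x"
proof -
  have "strict_mono_on UNIV F \<or> strict_antimono_on UNIV F"
    using injective_eq_monotone_map[OF is_interval_univ cont] assms by blast
  then show ?thesis
  proof
    assume mono: "strict_mono_on UNIV F"
    then have "F 0 < F (0 + 1)"
      by (auto simp: monotone_on_def)
    then have "d \<ge> 1"
      unfolding degree by simp
    then show ?thesis
      using mono by (intro that(1)) (auto simp: monotone_on_def)
  next
    assume mono: "strict_antimono_on UNIV F"
    then have "F (0 + 1) < F 0"
      by (auto simp: monotone_on_def)
    then have "d \<le> - 1"
      unfolding degree by simp
    then show ?thesis
      using mono by (intro that(2)) (auto simp: monotone_on_def)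
  qed
qed

text \<open>The interval from \<open>w\<close> to \<open>w + 1\<close> is invariant under
  \<open>G\<close> and contains a lift of every point of the circle.\<close>

lemma not_dense_orbit_if_fixed_point:
  assumes G: "\<And>x. proj_circle (G x) = (f ^^ n) (proj_circle x)" "n > 0"
    and mono: "mono G" and fixed: "G w = w" "G (w + 1) = w + 1"
  shows "\<not> dense_orbit f c"
proof -
  obtain z where z: "proj_circle z = c" "w \<le> z" "z < w + 1"
    by (rule ex_lift_in_unit_interval)
  have "\<not> dense_orbit f (proj_circle z)"
  proof (rule not_dense_orbit_if_mono[OF G])
    show "mono_on {w..w + 1} G"
      using mono by (auto simp: mono_on_def mono_def)
    show "G ` {w..w + 1} \<subseteq> {w..w + 1}"
      using monoD[OF mono, of w] monoD[OF mono, of _ "w + 1"] fixed by auto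
  qed (use z in auto)
  then show ?thesis
    by (simp add: z(1))
qed

text \<open>A decreasing lift of degree \<open>-1\<close> has a fixed point \<open>w\<close>; its
  square is increasing and fixes both \<open>w\<close> and \<open>w + 1\<close>.\<close>

lemma degree_neq_minus_one:
  assumes anti: "\<And>x y. x < y \<Longrightarrow> F y < F x" and dense: "dense_orbit f c"
  shows "d \<noteq> - 1"
proof
  assume d: "d = - 1"
  \<comment> \<open>For such \<open>m\<close>, \<open>F m = F 0 - m\<close> is at most
    \<open>m\<close>, and \<open>F (- m) = F 0 + m\<close> is at least \<open>- m\<close>.\<close>
  define m where "m = \<lceil>\<bar>F 0\<bar>\<rceil>"
  have m: "\<bar>F 0\<bar> \<le> of_int m"
    by (simp add: m_def)
  have "F (of_int m) \<le> of_int m" "of_int (- m) \<le> F (of_int (- m))"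
    using m add_of_int[of 0 m] add_of_int[of 0 "- m"] d by auto
  with cont obtain w where w: "F w = w"
    by (rule fixed_point_between)
  have "\<not> dense_orbit f c"
  proof (rule not_dense_orbit_if_fixed_point[where w = w])
    show "proj_circle ((F \<circ> F) x) = (f ^^ 2) (proj_circle x)" for x
      by (simp add: proj_lift numeral_2_eq_2)
    show "mono (F \<circ> F)"
      using anti by (intro monoI) (metis comp_apply order_le_less)
    show "(F \<circ> F) w = w" "(F \<circ> F) (w + 1) = w + 1"
      using w degree[of w] add_of_int[of w "- 1"] d by simp_all
  qed simp
  with dense show False
    by blast
qed

text \<open>In degree one, \<open>F ^^ n\<close> minus \<open>p\<close> is increasing and commutes
  with translation by one, so a fixed point \<open>w\<close> brings \<open>w + 1\<close>
  along.\<close>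

lemma no_fixed_point_funpow:
  assumes mono: "\<And>x y. x < y \<Longrightarrow> F x < F y" and dense: "dense_orbit f c"
    and d: "d = 1" and n: "n > 0"
  shows "(F ^^ n) w - of_int p \<noteq> w"
proof
  assume w: "(F ^^ n) w - of_int p = w"
  have "\<not> dense_orbit f c"
  proof (rule not_dense_orbit_if_fixed_point[where w = w])
    show "proj_circle ((F ^^ n) x - of_int p) = (f ^^ n) (proj_circle x)" for x
      by (simp add: proj_funpow)
    have "mono F"
      using mono by (intro monoI) (metis order_le_less)
    then show "mono (\<lambda>x. (F ^^ n) x - of_int p)"
      by (auto simp: mono_def funpow_mono)
    show "(F ^^ n) (w + 1) - of_int p = w + 1"
      using funpow_add_of_int[of n w 1] w d by simp
  qed (rule n, rule w)
  with dense show False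
    by blast
qed

text \<open>Pick \<open>n > 0\<close> and \<open>p\<close> with \<open>x < F\<^sup>n(x) - p < x + \<epsilon>/2\<close> and let \<open>G = F\<^sup>n - p\<close>. The pseudo-orbit
  \<open>x\<^sub>k\<^sub>+\<^sub>1 = F(x\<^sub>k) - \<epsilon>/2\<close> stays bounded modulo the translations by \<open>p\<close>, so the orbit under \<open>G\<close> of a
  point shadowing it is bounded. But it increases, so it converges to a fixed point of \<open>G\<close>.\<close>

lemma degree_neq_one:
  assumes mono: "\<And>x y. x < y \<Longrightarrow> F x < F y" and dense: "dense_orbit f c"
    and \<epsilon>: "\<epsilon> > 0"
    and shadowing: "\<And>X. (\<And>n. \<bar>F (X n) - X (Suc n)\<bar> < \<epsilon>) \<Longrightarrow> \<exists>y. \<forall>n. \<bar>(F ^^ n) y - X n\<bar> < \<eta>"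
  shows "d \<noteq> 1"
proof
  assume d: "d = 1"
  define x where "x = rep_circle c"
  have mono': "F u \<le> F v" if "u \<le> v" for u v
    using that mono by (metis order_le_less)
  have "x < x + \<epsilon> / 2"
    using \<epsilon> by simp
  moreover have "dense_orbit f (proj_circle x)"
    using dense by (simp add: x_def)
  ultimately obtain n p where n: "n \<ge> Suc 0" and
    return_time: "x < (F ^^ n) x - of_int p" "(F ^^ n) x - of_int p < x + \<epsilon> / 2"
    using dense_orbit_visits_lift by metis
  define G where "G = (\<lambda>u. (F ^^ n) u - of_int p)"
  have cont_G: "continuous_on UNIV G"
    unfolding G_def by (intro continuous_on_diff cont_funpow continuous_on_const)
  have no_fixed: "G w \<noteq> w" for w
    using no_fixed_point_funpow[OF mono dense d] n by (simp add: G_def)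
  \<comment> \<open>The inequality holds at \<open>x\<close>; failing elsewhere, it would produce a
    fixed point in between.\<close>
  have G_gt: "G w > w" for w
  proof (rule ccontr)
    assume "\<not> G w > w"
    then obtain u where "G u = u"
      using fixed_point_between[OF cont_G, of w x] return_time(1) by (auto simp: G_def)
    with no_fixed show False
      by blast
  qed
  \<comment> \<open>Orbits of \<open>E\<close> are \<epsilon>-pseudo-orbits of \<open>F\<close>.
    Since \<open>E\<close> also has degree one, its iterates commute with integer
    translations.\<close>
  define E where "E = (\<lambda>u. F u - \<epsilon> / 2)"
  interpret E: circle_lift "\<lambda>c. proj_circle (E (rep_circle c))" E 1
  proof
    show deg: "E (u + 1) = E u + of_int 1" for u
      by (simp add: E_def degree d)
    show "is_lift (\<lambda>c. proj_circle (E (rep_circle c))) E"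
    proof (rule is_lift_descend[of E 1, OF _ deg])
      show "continuous_on UNIV E"
        unfolding E_def by (intro continuous_on_diff cont continuous_on_const)
    qed
  qed
  have "mono E"
    by (intro monoI) (simp add: E_def mono')
  have E_le: "(E ^^ k) u \<le> (F ^^ k) u" for k u
  proof (induction k)
    case (Suc k)
    have "E ((E ^^ k) u) \<le> F ((E ^^ k) u)"
      using \<epsilon> by (simp add: E_def)
    also have "\<dots> \<le> F ((F ^^ k) u)"
      by (rule mono'[OF Suc])
    finally show ?case
      by simp
  qed simp
  \<comment> \<open>The loss of \<open>\<epsilon> / 2\<close> in the last step alone outweighs the
    surplus of the return of \<open>x\<close>.\<close>
  have E_n: "(E ^^ n) x \<le> x + of_int p"
  proof -
    obtain k where k: "n = Suc k"
      using n by (metis Suc_le_D)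
    have "(E ^^ n) x = F ((E ^^ k) x) - \<epsilon> / 2"
      by (simp add: k E_def)
    also have "\<dots> \<le> F ((F ^^ k) x) - \<epsilon> / 2"
      using mono'[OF E_le] by simp
    finally show ?thesis
      using return_time(2) by (simp add: k)
  qed
  have E_nk: "(E ^^ (n * k)) x \<le> x + of_int (int k * p)" for k
  proof (induction k)
    case (Suc k)
    have "(E ^^ (n * Suc k)) x = (E ^^ n) ((E ^^ (n * k)) x)"
      by (simp add: funpow_add)
    also have "\<dots> \<le> (E ^^ n) (x + of_int (int k * p))"
      by (rule funpow_mono[OF \<open>mono E\<close> Suc])
    also have "\<dots> = (E ^^ n) x + of_int (int k * p)"
      using E.funpow_add_of_int[of n x "int k * p"] by simp
    also have "\<dots> \<le> x + of_int (int (Suc k) * p)"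
      using E_n by (simp add: algebra_simps)
    finally show ?case .
  qed simp
  have "\<bar>F ((E ^^ k) x) - (E ^^ Suc k) x\<bar> < \<epsilon>" for k
    using \<epsilon> by (simp add: E_def)
  from shadowing[of "\<lambda>k. (E ^^ k) x", OF this]
  obtain y where y: "\<And>k. \<bar>(F ^^ k) y - (E ^^ k) x\<bar> < \<eta>"
    by blast
  have G_iterate: "(G ^^ k) y = (F ^^ (n * k)) y - of_int (int k * p)" for k
  proof (induction k)
    case (Suc k)
    have "(G ^^ Suc k) y = G ((F ^^ (n * k)) y - of_int (int k * p))"
      by (simp add: Suc)
    also have "\<dots> = (F ^^ n) ((F ^^ (n * k)) y + of_int (- (int k * p))) - of_int p"
      by (simp add: G_def)
    also have "\<dots> = (F ^^ (n * Suc k)) y - of_int (int (Suc k) * p)"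
      unfolding funpow_add_of_int by (simp add: d funpow_add algebra_simps)
    finally show ?case .
  qed simp
  have "incseq (\<lambda>k. (G ^^ k) y)"
    using G_gt by (intro incseq_SucI) (simp add: less_imp_le)
  moreover have "(G ^^ k) y \<le> x + \<eta>" for k
    using y[of "n * k"] E_nk[of k] unfolding G_iterate by linarith
  ultimately obtain q where q: "(\<lambda>k. (G ^^ k) y) \<longlonglongrightarrow> q"
    using incseq_convergent by blast
  then have "(\<lambda>k. G ((G ^^ k) y)) \<longlonglongrightarrow> G q"
    by (intro continuous_on_tendsto_compose[OF cont_G]) auto
  moreover have "(\<lambda>k. G ((G ^^ k) y)) \<longlonglongrightarrow> q"
    using LIMSEQ_Suc[OF q] by simp
  ultimately have "G q = q"
    by (rule LIMSEQ_unique)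
  with no_fixed show False
    by blast
qed

text \<open>\<open>H = lim F\<^sup>n / d\<^sup>n\<close>, written as a telescoping series.\<close>

lemma semiconjugacy_to_linear:
  assumes d: "\<bar>d\<bar> \<ge> 2"
    and mono: "\<And>x y. x \<le> y \<Longrightarrow> 0 \<le> of_int d * (F y - F x)"
  obtains H :: "real \<Rightarrow> real" where "continuous_on UNIV H" "\<And>x. H (x + 1) = H x + 1"
    "\<And>x. H (F x) = of_int d * H x" "mono H"
proof -
  \<comment> \<open>The deviation from the linear map is periodic, hence bounded, so the series has
    a geometric majorant.\<close>
  define \<phi> where "\<phi> = (\<lambda>x. F x - of_int d * x)"
  have cont_\<phi>: "continuous_on UNIV \<phi>"
    unfolding \<phi>_def by (intro continuous_on_diff cont continuous_on_mult continuous_on_const continuous_on_id)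
  have "\<phi> (x + 1) = \<phi> x" for x
    unfolding \<phi>_def degree by (simp add: algebra_simps)
  from periodic_bounded[OF cont_\<phi> this] obtain M where M: "\<And>x. \<bar>\<phi> x\<bar> \<le> M"
    by blast
  define D :: real where "D = of_int d"
  have D: "\<bar>D\<bar> \<ge> 2" "D \<noteq> 0"
    using d by (auto simp: D_def simp flip: of_int_abs)
  define t where "t = (\<lambda>k x. \<phi> ((F ^^ k) x) / D ^ Suc k)"
  have partial: "(F ^^ n) x / D ^ n = x + (\<Sum>k<n. t k x)" for n x
  proof (induction n)
    case (Suc n)
    have "(F ^^ Suc n) x / D ^ Suc n = (F ^^ n) x / D ^ n + t n x"
      using D(2) by (simp add: t_def \<phi>_def D_def field_simps)
    with Suc show ?case
      by simp
  qed simp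
  have t_le: "norm (t k x) \<le> M * (1 / 2) ^ k" for k x
  proof -
    have "2 ^ k \<le> \<bar>D\<bar> ^ Suc k"
    proof -
      have "(2::real) ^ k \<le> 2 ^ Suc k"
        by simp
      also have "\<dots> \<le> \<bar>D\<bar> ^ Suc k"
        using D(1) by (intro power_mono) auto
      finally show ?thesis .
    qed
    moreover have "0 \<le> M"
      using M[of 0] by linarith
    ultimately have "\<bar>\<phi> ((F ^^ k) x)\<bar> / \<bar>D\<bar> ^ Suc k \<le> M / 2 ^ k"
      by (intro frac_le M) simp_all
    moreover have "norm (t k x) = \<bar>\<phi> ((F ^^ k) x)\<bar> / \<bar>D\<bar> ^ Suc k"
      by (simp add: t_def power_abs del: power_Suc)
    moreover have "M / 2 ^ k = M * (1 / 2) ^ k"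
      by (simp add: power_divide)
    ultimately show ?thesis
      by simp
  qed
  define T where "T = (\<lambda>x. \<Sum>k. t k x)"
  have unif: "uniform_limit UNIV (\<lambda>n x. \<Sum>k<n. t k x) T sequentially"
    unfolding T_def
    by (rule Weierstrass_m_test[OF t_le]) (intro summable_mult summable_geometric, simp)
  have "continuous_on UNIV (\<lambda>x. \<Sum>k<n. t k x)" for n
  proof -
    have "continuous_on UNIV (\<lambda>x. \<phi> ((F ^^ k) x))" for k
      using continuous_on_compose2[OF cont_\<phi> cont_funpow[of k]] by simp
    then show ?thesis
      unfolding t_def using D(2) by (intro continuous_on_sum continuous_on_divide continuous_on_const) auto
  qed
  then have cont_T: "continuous_on UNIV T"
    using unif by (intro uniform_limit_theorem[OF _ unif]) auto
  define H where "H = (\<lambda>x. x + T x)"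
  have lim: "(\<lambda>n. (F ^^ n) x / D ^ n) \<longlonglongrightarrow> H x" for x
    unfolding partial H_def
    by (intro tendsto_add tendsto_const tendsto_uniform_limitI[OF unif]) simp
  show ?thesis
  proof (rule that)
    show "continuous_on UNIV H"
      unfolding H_def by (intro continuous_on_add continuous_on_id cont_T)
    show "H (x + 1) = H x + 1" for x
    proof (rule LIMSEQ_unique[OF lim])
      have "(F ^^ n) (x + 1) / D ^ n = (F ^^ n) x / D ^ n + 1" for n
        using funpow_add_of_int[of n x 1] D(2) by (simp add: D_def add_divide_distrib)
      then show "(\<lambda>n. (F ^^ n) (x + 1) / D ^ n) \<longlonglongrightarrow> H x + 1"
        by (simp add: tendsto_add[OF lim tendsto_const])
    qed
    show "H (F x) = of_int d * H x" for x
    proof (rule LIMSEQ_unique[OF lim])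
      have "(F ^^ n) (F x) / D ^ n = D * ((F ^^ Suc n) x / D ^ Suc n)" for n
        using D(2) by (simp add: funpow_swap1)
      then show "(\<lambda>n. (F ^^ n) (F x) / D ^ n) \<longlonglongrightarrow> of_int d * H x"
        using tendsto_mult_left[OF LIMSEQ_Suc[OF lim[of x]], of D] by (simp add: D_def)
    qed
    show "mono H"
    proof (rule monoI)
      fix x y :: real assume "x \<le> y"
      \<comment> \<open>For negative \<open>d\<close> every application of \<open>F\<close> reverses
        the order, and the sign of \<open>D ^ n\<close> compensates for it.\<close>
      have "0 \<le> D ^ n * ((F ^^ n) y - (F ^^ n) x)" if "x \<le> y" for n x y
        using that
      proof (induction n arbitrary: x y)
        case (Suc n)
        have swap: "(F ^^ Suc n) u = (F ^^ n) (F u)" for u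
          by (simp add: funpow_swap1)
        show ?case
        proof (cases "D > 0")
          case True
          then have "F x \<le> F y"
            using mono[OF Suc.prems] by (simp add: D_def zero_le_mult_iff)
          then have "0 \<le> D * (D ^ n * ((F ^^ n) (F y) - (F ^^ n) (F x)))"
            using True Suc.IH by simp
          then show ?thesis
            unfolding swap by (simp add: mult.assoc)
        next
          case False
          then have "F y \<le> F x"
            using mono[OF Suc.prems] D(2) by (simp add: D_def zero_le_mult_iff)
          then have "0 \<le> (- D) * (D ^ n * ((F ^^ n) (F x) - (F ^^ n) (F y)))"
            using False by (intro mult_nonneg_nonneg[OF _ Suc.IH]) simp
          then show ?thesis
            unfolding swap by (simp add: algebra_simps)
        qed
      qed simp
      from this[OF \<open>x \<le> y\<close>] have "0 \<le> ((F ^^ n) y - (F ^^ n) x) / D ^ n" for n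
        by (simp only: zero_le_divide_iff zero_le_mult_iff) blast
      then have "(F ^^ n) x / D ^ n \<le> (F ^^ n) y / D ^ n" for n
        by (simp add: diff_divide_distrib)
      then show "H x \<le> H y"
        by (intro LIMSEQ_le[OF lim lim] exI allI impI)
    qed
  qed
qed

text \<open>A nontrivial fibre of \<open>H\<close> would be mapped into itself by some \<open>F\<^sup>n - p\<close>, \<open>n > 0\<close>, because the
  dense orbit returns to its interior.\<close>

lemma semiconjugacy_strict_mono:
  fixes H :: "real \<Rightarrow> real"
  assumes H: "\<And>x. H (x + 1) = H x + 1" "\<And>x. H (F x) = of_int d * H x" "mono H"
    and mono: "\<And>x y. x \<le> y \<Longrightarrow> 0 \<le> of_int d * (F y - F x)" and "d \<noteq> 0"
    and dense: "dense_orbit f c"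
  shows "strict_mono H"
proof (rule strict_monoI)
  fix a b :: real assume "a < b"
  have H_int: "H (x + of_int m) = H x + of_int m" for x m
    using degree_add_of_int[of H 1 x m] H(1) by simp
  have H_funpow: "H ((F ^^ n) x) = of_int (d ^ n) * H x" for n x
    by (induction n) (auto simp: H(2))
  have "H a \<noteq> H b"
  proof
    assume eq: "H a = H b"
    define J where "J = {x. H x = H a}"
    have sub: "{a<..<b} \<subseteq> J"
    proof
      fix u assume "u \<in> {a<..<b}"
      then show "u \<in> J"
        using monoD[OF H(3), of a u] monoD[OF H(3), of u b] eq by (simp add: J_def)
    qed
    have "dense_orbit f (proj_circle (rep_circle c))"
      using dense by simp
    from this \<open>a < b\<close> obtain n0 p0 where "a < (F ^^ n0) (rep_circle c) - of_int p0"
      "(F ^^ n0) (rep_circle c) - of_int p0 < b"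
      by (rule dense_orbit_visits_lift)
    \<comment> \<open>A point of the dense orbit is moved into the fibre, so that its own later
      returns can be used.\<close>
    define z where "z = (F ^^ n0) (rep_circle c) - of_int p0"
    have z: "a < z" "z < b"
      unfolding z_def by fact+
    have "proj_circle z = (f ^^ n0) c"
      by (simp add: z_def proj_funpow)
    then have dense_z: "dense_orbit f (proj_circle z)"
      using dense_orbit_tail[OF dense] by simp
    from this \<open>a < b\<close> obtain n p where n: "n \<ge> Suc 0" and
      return_time: "a < (F ^^ n) z - of_int p" "(F ^^ n) z - of_int p < b"
      by (rule dense_orbit_visits_lift)
    define G where "G = (\<lambda>u. (F ^^ n) u - of_int p)"
    have zJ: "z \<in> J" and GzJ: "G z \<in> J"
      using z return_time sub by (auto simp: G_def)
    have HG: "H (G u) = of_int (d ^ n) * H u - of_int p" for u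
      using H_int[of "(F ^^ n) u" "- p"] by (simp add: G_def H_funpow)
    \<comment> \<open>\<open>H (G u)\<close> depends only on \<open>H u\<close>, so \<open>G\<close>
      maps the fibre \<open>J\<close> into a single fibre; the point \<open>G z\<close> shows that
      it is \<open>J\<close> again.\<close>
    have GJ: "G u \<in> J" if "u \<in> J" for u
      using HG[of u] HG[of z] that zJ GzJ by (simp add: J_def)
    have "\<not> dense_orbit f (proj_circle z)"
    proof (rule not_dense_orbit_if_mono)
      \<comment> \<open>The square is taken because \<open>G\<close> itself may reverse
        orientation.\<close>
      show "proj_circle ((G \<circ> G) x) = (f ^^ (n + n)) (proj_circle x)" for x
        by (simp add: G_def proj_funpow funpow_add)
      show "n + n > 0"
        using n by simp
      show "mono_on J (G \<circ> G)"
      proof -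
        have "mono (F ^^ k) \<or> antimono (F ^^ k)" for k
        proof (induction k)
          case (Suc k)
          have "mono F \<or> antimono F"
          proof (cases "d > 0")
            case True
            then have "mono F"
              using mono by (intro monoI) (simp add: zero_le_mult_iff)
            then show ?thesis ..
          next
            case False
            then have "antimono F"
              using mono \<open>d \<noteq> 0\<close> by (intro antimonoI) (simp add: zero_le_mult_iff)
            then show ?thesis ..
          qed
          with Suc show ?case
            by (auto simp: mono_def antimono_def)
        qed (simp add: mono_def)
        from this[of n] show ?thesis
          by (auto simp: mono_def antimono_def mono_on_def G_def)
      qed
      show "(G \<circ> G) ` J \<subseteq> J"
        using GJ by auto
      \<comment> \<open>\<open>H\<close> grows by one over each unit interval, so no fibre extends
        that far.\<close>
      have "J \<subseteq> {a - 1..a + 1}"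
      proof
        fix u assume u: "u \<in> J"
        have "\<not> u > a + 1"
          using monoD[OF H(3), of "a + 1" u] H(1)[of a] u by (auto simp: J_def)
        moreover have "\<not> u < a - 1"
          using monoD[OF H(3), of u "a - 1"] H(1)[of "a - 1"] u by (auto simp: J_def)
        ultimately show "u \<in> {a - 1..a + 1}"
          by auto
      qed
      then show "bounded J"
        by (rule bounded_subset[OF bounded_closed_interval])
    qed (rule zJ)
    with dense_z show False
      by blast
  qed
  moreover have "H a \<le> H b"
    using H(3) \<open>a < b\<close> by (simp add: mono_def)
  ultimately show "H a < H b"
    by simp
qed

text \<open>\<open>H\<close> is a homeomorphism of the line commuting with integer translations, so
  \<open>H\<close> and its inverse descend to the circle.\<close>

lemma conjugate_to_linear:
  assumes d: "\<bar>d\<bar> \<ge> 2" and mono: "\<And>x y. x \<le> y \<Longrightarrow> 0 \<le> of_int d * (F y - F x)"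
    and dense: "dense_orbit f c"
  shows "topologically_conjugate f (linear_endomorphism d)"
proof -
  obtain H :: "real \<Rightarrow> real" where H: "continuous_on UNIV H" "\<And>x. H (x + 1) = H x + 1"
    "\<And>x. H (F x) = of_int d * H x" "mono H"
    using semiconjugacy_to_linear[OF d mono] by metis
  have "d \<noteq> 0"
    using d by auto
  then have strict: "strict_mono H"
    using semiconjugacy_strict_mono[OF H(2-4) mono _ dense] by blast
  have H_int: "H (x + of_int m) = H x + of_int m" for x m
    using degree_add_of_int[of H 1 x m] H(2) by simp
  have "surj H"
  proof (rule surjI)
    fix y
    have "connected (range H)"
      by (intro connected_continuous_image H(1)) simp
    from connected_contains_Icc[OF this, of "H (of_int (\<lfloor>y - H 0\<rfloor>))" "H (of_int (\<lceil>y - H 0\<rceil>))"]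
    moreover have "H (of_int m) = H 0 + of_int m" for m
      using H_int[of 0 m] by simp
    then have "H (of_int \<lfloor>y - H 0\<rfloor>) \<le> y" "y \<le> H (of_int \<lceil>y - H 0\<rceil>)"
      using of_int_floor_le[of "y - H 0"] le_of_int_ceiling[of "y - H 0"]
      by (simp_all only: le_diff_eq diff_le_eq add.commute)
    ultimately have "y \<in> range H"
      by auto
    then show "H (inv H y) = y"
      by (rule f_inv_into_f)
  qed
  define H' where "H' = inv H"
  have HH': "H (H' y) = y" for y
    unfolding H'_def by (rule surj_f_inv_f[OF \<open>surj H\<close>])
  have H'H: "H' (H x) = x" for x
    unfolding H'_def by (rule inv_f_f[OF strict_mono_imp_inj_on[OF strict]])
  \<comment> \<open>A monotone function with open range is continuous.\<close>
  have "continuous_on UNIV H'"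
  proof (rule continuous_onI_mono)
    have "range H' = UNIV"
      using H'H by (metis surjI)
    then show "open (H' ` UNIV)"
      by simp
    show "H' x \<le> H' y" if "x \<le> y" for x y
      using that strict_mono_less_eq[OF strict, of "H' x" "H' y"] by (simp add: HH')
  qed
  moreover have "H' (y + 1) = H' y + 1" for y
    using H(2)[of "H' y"] H'H[of "H' y + 1"] by (simp add: HH')
  ultimately have lift': "is_lift (\<lambda>c. proj_circle (H' (rep_circle c))) H'"
    using is_lift_descend[of H' 1] by simp
  have lift_H: "is_lift (\<lambda>c. proj_circle (H (rep_circle c))) H"
    using is_lift_descend[of H 1] H(1,2) by simp
  define h h' where "h = (\<lambda>c. proj_circle (H (rep_circle c)))"
    and "h' = (\<lambda>c. proj_circle (H' (rep_circle c)))"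
  have h: "h (proj_circle x) = proj_circle (H x)" "h' (proj_circle x) = proj_circle (H' x)" for x
    using lift' lift_H by (simp_all add: is_lift_def h_def h'_def)
  have h'h: "h' (h c) = c" and hh': "h (h' c) = c" and hf: "h (f c) = linear_endomorphism d (h c)" for c
  proof -
    obtain x where x: "c = proj_circle x"
      by (metis proj_rep_circle)
    show "h' (h c) = c" "h (h' c) = c"
      by (simp_all add: x h H'H HH')
    show "h (f c) = linear_endomorphism d (h c)"
      by (simp add: x h H(3) linear_endomorphism.abs_eq flip: proj_lift)
  qed
  have "homeomorphism UNIV UNIV h h'"
  proof (rule homeomorphismI)
    show "continuous_on UNIV h" "continuous_on UNIV h'"
      using lift' lift_H is_lift_continuous by (simp_all add: h_def h'_def)
  qed (auto simp: h'h hh')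
  moreover have "h \<circ> f = linear_endomorphism d \<circ> h"
    by (auto simp: hf)
  ultimately show ?thesis
    unfolding topologically_conjugate_def by blast
qed

end

theorem theorem1p6:
  fixes f :: "circle \<Rightarrow> circle" and \<alpha> :: real
  assumes "C2_endomorphism f"
    and "finite {c. turning_point f c}"
    and "transitive_map f"
    and "1 / 2 < \<alpha>" and "\<alpha> \<le> 1"
    and "holder_shadowing \<alpha> f"
  shows "\<exists>k::int. \<bar>k\<bar> \<ge> 2 \<and> topologically_conjugate f (linear_endomorphism k)"
proof -
  obtain F where F: "is_lift f F" "C2_real F"
    using assms(1) by (auto simp: C2_endomorphism_def)
  obtain d :: int where d: "\<And>x. F (x + 1) = F x + of_int d"
    using is_lift_degree[OF F(1)] by blast
  interpret circle_lift f F d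
    by unfold_locales (rule F(1), rule d)
  obtain c where dense: "dense_orbit f c"
    using assms(3) by (auto simp: transitive_map_def dense_orbit_def)
  from C2_lift_bounds[OF F(2)] obtain F' K where K: "K > 0"
    and deriv: "\<And>x. (F has_real_derivative F' x) (at x)"
    and lip: "\<And>x y. \<bar>F x - F y\<bar> \<le> K * \<bar>x - y\<bar>"
    by metis
  have "\<alpha> > 0" "K \<ge> 0"
    using assms(4) K by simp_all
  from holder_shadowing_lift[OF assms(6) this(1) lip this(2)] obtain C where
    "\<forall>\<^sub>F \<epsilon> in at_right 0. \<forall>X. (\<forall>n. \<bar>F (X n) - X (Suc n)\<bar> < \<epsilon>) \<longrightarrow>
      (\<exists>y. \<forall>n. \<bar>(F ^^ n) y - X n\<bar> < C * \<epsilon> powr \<alpha>)" .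
  \<comment> \<open>One scale of shadowing is enough for excluding degree one.\<close>
  from eventually_happens'[OF trivial_limit_at_right_real
      eventually_conj[OF this eventually_at_right_less[of 0]]]
  obtain \<epsilon> where \<epsilon>: "\<epsilon> > 0" and shadowing: "\<And>X. (\<And>n. \<bar>F (X n) - X (Suc n)\<bar> < \<epsilon>) \<Longrightarrow>
      \<exists>y. \<forall>n. \<bar>(F ^^ n) y - X n\<bar> < C * \<epsilon> powr \<alpha>"
    by auto
  have "\<not> critical_extremum F x" for x
    by (rule no_critical_extremum_if_shadowing[OF F(2) assms(2) dense assms(4,6)])
  from inj_if_no_critical_extremum[OF deriv this] have "inj F" .
  \<comment> \<open>The product expresses monotonicity for both orientations at once.\<close>
  then have "\<bar>d\<bar> \<ge> 2 \<and> (\<forall>x y. x \<le> y \<longrightarrow> 0 \<le> of_int d * (F y - F x))"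
  proof (cases rule: monotone_cases)
    case 1
    have "d \<noteq> 1"
      using degree_neq_one[OF 1(2) dense \<epsilon> shadowing] .
    moreover have "F x \<le> F y" if "x \<le> y" for x y
      using that 1(2) by (metis order_le_less)
    ultimately show ?thesis
      using 1(1) by (auto intro: mult_nonneg_nonneg)
  next
    case 2
    have "d \<noteq> - 1"
      using degree_neq_minus_one[OF 2(2) dense] .
    moreover have "F y \<le> F x" if "x \<le> y" for x y
      using that 2(2) by (metis order_le_less)
    ultimately show ?thesis
      using 2(1) by (auto intro: mult_nonpos_nonpos)
  qed
  then have "\<bar>d\<bar> \<ge> 2" "topologically_conjugate f (linear_endomorphism d)"
    using conjugate_to_linear[OF _ _ dense] by blast+
  then show ?thesis
    by blast
qed

end
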